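(* Let $C_*>0$ be an absolute constant for which the Carbery–Wright inequality for quadratics (stated in the context) holds. For every integer $d\ge 1$ and every real $\epsilon>0$, the algorithm GaussianMeanTester (defined in the context, with parameter $n=\lceil 25\,C_*^2\sqrt{d}/\epsilon^2\rceil$) solves the problem Gaussian-Mean-Testing; that is: (Completeness) if $p=\mathcal{N}(0,I_d)$, the algorithm outputs "ACCEPT" with probability at least $2/3$; (Soundness) if $p=\mathcal{N}(\mu,\Sigma)$ for some $\mu\in\mathbb{R}^d$ with $\|\mu\|_2\ge\epsilon$ and some (arbitrary, unknown) positive semidefinite $\Sigma\in\mathbb{R}^{d\times d}$, the algorithm outputs "REJECT" with probability at least $2/3$. Moreover $n=\Theta\left(\max(1,\sqrt{d}/\epsilon^2)\right)$, i.e. there are absolute constants $0<c\le C$ (depending only on $C_*$) such that $c\max(1,\sqrt{d}/\epsilon^2)\le n\le C\max(1,\sqrt{d}/\epsilon^2)$ for all $d$ and $\epsilon$, and the algorithm, which draws $2n$ samples, can be implemented in $O(n\,d)$ time.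
   Context: Notation: $\mathcal{N}(\mu,\Sigma)$ is the Gaussian distribution on $\mathbb{R}^d$ with mean $\mu$ and covariance $\Sigma$ (positive semidefinite, possibly singular), $I_d$ is the $d\times d$ identity matrix, and $\|\cdot\|_2$ is the Euclidean norm. Running time counts real arithmetic operations and comparisons. Problem Gaussian-Mean-Testing. Input: i.i.d. sample access to a distribution $p$ on $\mathbb{R}^d$, and $\epsilon>0$. Required output: "ACCEPT" with probability at least $2/3$ if $p=\mathcal{N}(0,I_d)$; "REJECT" with probability at least $2/3$ if $p=\mathcal{N}(\mu,\Sigma)$ for some $\mu$ with $\|\mu\|_2\ge\epsilon$ and some covariance $\Sigma$. Probabilities are over the samples drawn. Carbery–Wright inequality for quadratics (known result, used to define the constant $C_*$): there is an absolute constant $C_*>0$ such that for every integer $m\ge1$, every nonzero real polynomial $q:\mathbb{R}^m\to\mathbb{R}$ of degree at most $2$, and every $\alpha\in(0,\infty)$, if $G\sim\mathcal{N}(0,I_m)$ then $\mathbb{P}\left(|q(G)|\le\alpha\sqrt{\mathbf{E}[q(G)^2]}\right)\le C_*\sqrt{\alpha}$. Algorithm GaussianMeanTester, on input sample access to $p$ and $\epsilon>0$: 1. Set $n=\lceil 25\,C_*^2\sqrt{d}/\epsilon^2\rceil$. 2. Draw $2n$ i.i.d. samples $X_1,\dots,X_n,Y_1,\dots,Y_n$ from $p$. 3. Compute $Z=\frac{1}{n^2}\left(\sum_{i=1}^n X_i\right)^\top\left(\sum_{i=1}^n Y_i\right)$. 4. If $|Z|\le\sqrt{3d}/n$ output "ACCEPT";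 otherwise output "REJECT". *)

theory Defs
  imports "HOL-Probability.Probability"
begin

text \<open>The dimension is quantified inside the statement, so a vector of \<open>\<real>\<^sup>d\<close> is a function
  of type \<^typ>\<open>nat \<Rightarrow> real\<close> read on the indices below \<open>d\<close>, its norm is
  \<^term>\<open>L2_set x {..<d}\<close>, and a \<open>d \<times> d\<close> matrix is a function of two indices below \<open>d\<close>.\<close>

definition borel_vec :: "nat \<Rightarrow> (nat \<Rightarrow> real) measure" where
  "borel_vec d = (\<Pi>\<^sub>M i\<in>{..<d}. borel)"

definition std_gaussian :: "nat \<Rightarrow> (nat \<Rightarrow> real) measure" where
  "std_gaussian d = (\<Pi>\<^sub>M i\<in>{..<d}. density lborel std_normal_density)"

definition psd :: "nat \<Rightarrow> (nat \<Rightarrow> nat \<Rightarrow> real) \<Rightarrow> bool" where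
  "psd d S \<longleftrightarrow> (\<forall>i<d. \<forall>j<d. S i j = S j i) \<and>
     (\<forall>x :: nat \<Rightarrow> real. 0 \<le> (\<Sum>i<d. \<Sum>j<d. x i * S i j * x j))"

definition id_matrix :: "nat \<Rightarrow> nat \<Rightarrow> real" where
  "id_matrix i j = (if i = j then 1 else 0)"

text \<open>\<open>gaussian d \<mu> S p\<close> says that \<open>p\<close> is \<open>\<N>(\<mu>, S)\<close>: the law of \<open>\<mu> + A G\<close>, where \<open>G\<close> is standard
  Gaussian on \<open>\<real>\<^sup>d\<close> and \<open>A A\<^sup>T = S\<close>. The law does not depend on the factor \<open>A\<close>, and no invertibility
  of \<open>S\<close> is needed; the lemma \<open>gaussian_exists\<close> below shows that the law exists for every
  positive semidefinite \<open>S\<close>.\<close>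

definition gaussian ::
  "nat \<Rightarrow> (nat \<Rightarrow> real) \<Rightarrow> (nat \<Rightarrow> nat \<Rightarrow> real) \<Rightarrow> (nat \<Rightarrow> real) measure \<Rightarrow> bool" where
  "gaussian d \<mu> S p \<longleftrightarrow>
     (\<exists>A :: nat \<Rightarrow> nat \<Rightarrow> real.
        (\<forall>i<d. \<forall>j<d. S i j = (\<Sum>k<d. A i k * A j k)) \<and>
        p = distr (std_gaussian d) (borel_vec d)
              (\<lambda>g. \<lambda>i\<in>{..<d}. \<mu> i + (\<Sum>k<d. A i k * g k)))"

lemma psd_factor:
  assumes "psd d S"
  shows "\<exists>A :: nat \<Rightarrow> nat \<Rightarrow> real. \<forall>i<d. \<forall>j<d. S i j = (\<Sum>k<d. A i k * A j k)"
  using assms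
proof (induction d arbitrary: S)
  case 0
  then show ?case by simp
next
  case (Suc d)
  have sym: "S i j = S j i" if "i < Suc d" "j < Suc d" for i j
    using Suc.prems that by (auto simp: psd_def)
  have pos: "0 \<le> (\<Sum>i<d. \<Sum>j<d. x i * S i j * x j) + 2 * t * (\<Sum>i<d. x i * S i d) + t\<^sup>2 * S d d"
    for x :: "nat \<Rightarrow> real" and t
  proof -
    have "0 \<le> (\<Sum>i<Suc d. \<Sum>j<Suc d. (x(d := t)) i * S i j * (x(d := t)) j)"
      using Suc.prems unfolding psd_def by blast
    also have "\<dots> = (\<Sum>i<d. (\<Sum>j<d. x i * S i j * x j) + x i * S i d * t)
        + ((\<Sum>j<d. t * S d j * x j) + t * S d d * t)"
      by simp
    also have "(\<Sum>j<d. t * S d j * x j) = t * (\<Sum>i<d. x i * S i d)"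
      by (auto simp: sum_distrib_left sym[of d] intro!: sum.cong)
    also have "(\<Sum>i<d. (\<Sum>j<d. x i * S i j * x j) + x i * S i d * t)
        = (\<Sum>i<d. \<Sum>j<d. x i * S i j * x j) + t * (\<Sum>i<d. x i * S i d)"
      by (simp add: sum.distrib sum_distrib_left mult_ac)
    finally show ?thesis by (simp add: power2_eq_square algebra_simps)
  qed
  have dd: "0 \<le> S d d"
    using pos[of "\<lambda>_. 0" 1] by simp
  define u where "u = (\<lambda>i. S i d / sqrt (S d d))"
  define T where "T = (\<lambda>i j. S i j - u i * u j)"
  have zero: "S i d = 0" if "S d d = 0" "i < d" for i
  proof (rule ccontr)
    assume ne: "S i d \<noteq> 0"
    define x :: "nat \<Rightarrow> real" where "x = (\<lambda>k. if k = i then 1 else 0)"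
    have 1: "(\<Sum>k<d. x k * S k d) = S i d"
      using that by (simp add: x_def if_distrib[of "\<lambda>a. a * _"] cong: if_cong)
    define Q where "Q = (\<Sum>i<d. \<Sum>j<d. x i * S i j * x j)"
    have "0 \<le> Q + 2 * (- (Q + 1) / (2 * S i d)) * S i d"
      using pos[of x "- (Q + 1) / (2 * S i d)"] unfolding 1 that(1) Q_def by simp
    also have "2 * (- (Q + 1) / (2 * S i d)) * S i d = - (Q + 1)"
      using ne by (simp add: field_simps)
    finally show False by simp
  qed
  have uu: "u i * sqrt (S d d) = S i d" if "i < d" for i
    using zero[OF _ that] dd by (cases "S d d = 0") (auto simp: u_def)
  have "psd d T"
    unfolding psd_def
  proof (intro conjI allI impI)
    show "T i j = T j i" if "i < d" "j < d" for i j
      using that sym[of i j] by (simp add: T_def)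
  next
    fix x :: "nat \<Rightarrow> real"
    define L where "L = (\<Sum>i<d. x i * u i)"
    have L: "(\<Sum>i<d. x i * S i d) = L * sqrt (S d d)"
      unfolding L_def sum_distrib_right by (intro sum.cong) (auto simp: uu[symmetric])
    have "(\<Sum>i<d. \<Sum>j<d. x i * T i j * x j) = (\<Sum>i<d. \<Sum>j<d. x i * S i j * x j) - L\<^sup>2"
      by (simp add: T_def L_def power2_eq_square sum_product algebra_simps sum_subtractf)
    moreover have "0 \<le> (\<Sum>i<d. \<Sum>j<d. x i * S i j * x j) - L\<^sup>2"
    proof (cases "S d d = 0")
      case True
      then have "L = 0" by (simp add: L_def u_def)
      then show ?thesis using pos[of x 0] by simp
    next
      case False
      with dd have s: "sqrt (S d d) > 0" by simp
      have "(- L / sqrt (S d d))\<^sup>2 * S d d = L\<^sup>2"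
        using False dd by (simp add: power_divide)
      moreover have "2 * (- L / sqrt (S d d)) * (\<Sum>i<d. x i * S i d) = - 2 * L\<^sup>2"
        using s by (simp add: L power2_eq_square)
      ultimately show ?thesis
        using pos[of x "- L / sqrt (S d d)"] by linarith
    qed
    ultimately show "0 \<le> (\<Sum>i<d. \<Sum>j<d. x i * T i j * x j)" by simp
  qed
  then obtain A :: "nat \<Rightarrow> nat \<Rightarrow> real"
    where A: "\<And>i j. i < d \<Longrightarrow> j < d \<Longrightarrow> T i j = (\<Sum>k<d. A i k * A j k)"
    using Suc.IH by blast
  define B where "B = (\<lambda>i k. if i = d then (if k = d then sqrt (S d d) else 0)
                             else (if k = d then u i else A i k))"
  have "S i j = (\<Sum>k<Suc d. B i k * B j k)" if "i < Suc d" "j < Suc d" for i j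
  proof -
    consider "i < d" "j < d" | "i < d" "j = d" | "i = d" "j < d" | "i = d" "j = d"
      using \<open>i < Suc d\<close> \<open>j < Suc d\<close> less_Suc_eq by blast
    then show ?thesis
    proof cases
      case 1
      then have "(\<Sum>k<Suc d. B i k * B j k) = (\<Sum>k<d. A i k * A j k) + u i * u j"
        by (simp add: B_def)
      then show ?thesis using A[OF 1] by (simp add: T_def)
    next
      case 2
      then show ?thesis by (simp add: B_def uu)
    next
      case 3
      then show ?thesis using sym[of d j] by (simp add: B_def uu mult.commute)
    next
      case 4
      then show ?thesis using dd by (simp add: B_def)
    qed
  qed
  then show ?case by blast
qed

lemma gaussian_exists: "psd d S \<Longrightarrow> \<exists>p. gaussian d \<mu> S p"
  using psd_factor unfolding gaussian_def by blast

definition quadratic :: "nat \<Rightarrow> ((nat \<Rightarrow> real) \<Rightarrow> real) \<Rightarrow> bool" where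
  "quadratic m q \<longleftrightarrow>
     (\<exists>(a :: real) (b :: nat \<Rightarrow> real) (c :: nat \<Rightarrow> nat \<Rightarrow> real).
        \<forall>x. q x = a + (\<Sum>i<m. b i * x i) + (\<Sum>i<m. \<Sum>j<m. c i j * x i * x j))"

text \<open>A polynomial over \<open>\<real>\<close> is nonzero exactly if it is nonzero as a function.\<close>

definition carbery_wright_const :: "real \<Rightarrow> bool" where
  "carbery_wright_const C \<longleftrightarrow> 0 < C \<and>
     (\<forall>m\<ge>1. \<forall>q. quadratic m q \<and> (\<exists>x. q x \<noteq> 0) \<longrightarrow>
       (\<forall>\<alpha>>0. measure (std_gaussian m)
            {g \<in> space (std_gaussian m).
               \<bar>q g\<bar> \<le> \<alpha> * sqrt (\<integral>x. (q x)\<^sup>2 \<partial>std_gaussian m)}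
          \<le> C * sqrt \<alpha>))"

datatype verdict = ACCEPT | REJECT

definition sample_num :: "real \<Rightarrow> nat \<Rightarrow> real \<Rightarrow> nat" where
  "sample_num C d \<epsilon> = nat \<lceil>25 * C\<^sup>2 * sqrt (real d) / \<epsilon>\<^sup>2\<rceil>"

text \<open>The \<open>2n\<close> samples form one sequence \<open>\<omega>\<close>: first \<open>X\<^sub>1, \<dots>, X\<^sub>n\<close>, then \<open>Y\<^sub>1, \<dots>, Y\<^sub>n\<close>.\<close>

definition statistic :: "nat \<Rightarrow> nat \<Rightarrow> (nat \<Rightarrow> nat \<Rightarrow> real) \<Rightarrow> real" where
  "statistic d n \<omega> =
     1 / (real n)\<^sup>2 * (\<Sum>j<d. (\<Sum>i<n. \<omega> i j) * (\<Sum>i<n. \<omega> (n + i) j))"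

definition tester :: "real \<Rightarrow> nat \<Rightarrow> real \<Rightarrow> (nat \<Rightarrow> nat \<Rightarrow> real) \<Rightarrow> verdict" where
  "tester C d \<epsilon> \<omega> =
     (let n = sample_num C d \<epsilon>
      in if \<bar>statistic d n \<omega>\<bar> \<le> sqrt (3 * real d) / real n then ACCEPT else REJECT)"

definition output_prob :: "real \<Rightarrow> nat \<Rightarrow> real \<Rightarrow> (nat \<Rightarrow> real) measure \<Rightarrow> verdict \<Rightarrow> real" where
  "output_prob C d \<epsilon> p v =
     (let P = (\<Pi>\<^sub>M i\<in>{..<2 * sample_num C d \<epsilon>}. p)
      in measure P {\<omega> \<in> space P. tester C d \<epsilon> \<omega> = v})"

text \<open>Running time is measured on programs of a real RAM. A program has natural-number registers
  (for counting and addressing) and a memory of reals addressed by natural numbers. The only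
  operations on reals are the four field operations and comparisons, with arbitrary real constants
  allowed; there is no rounding and no square root. Samples are obtained only by \<open>Draw\<close>, which
  puts the next sample into a buffer whose coordinates \<open>Coord\<close> reads.

  The cost is at least the number of real arithmetic operations and comparisons executed: it
  also charges for constants, memory accesses, index arithmetic and every command, and charges
  \<open>d + 1\<close> for drawing a sample.\<close>

datatype nexp =
    NConst nat
  | Reg nat
  | NAdd nexp nexp
  | NSub nexp nexp

datatype rexp =
    RConst real
  | Mem nexp
  | Coord nexp
  | OfNat nexp
  | RAdd rexp rexp
  | RSub rexp rexp
  | RMul rexp rexp
  | RDiv rexp rexp

datatype test =
    NLess nexp nexp
  | RLess rexp rexp
  | RLe rexp rexp

datatype com =
    Skip
  | SetReg nat nexp
  | SetMem nexp rexp
  | Draw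
  | Answer verdict
  | Seq com com
  | Cond test com com
  | While test com

record state =
  reg :: "nat \<Rightarrow> nat"
  mem :: "nat \<Rightarrow> real"
  buf :: "nat \<Rightarrow> real"
  drawn :: nat
  answer :: "verdict option"

fun nval :: "nexp \<Rightarrow> state \<Rightarrow> nat" where
  "nval (NConst k) s = k"
| "nval (Reg r) s = reg s r"
| "nval (NAdd a b) s = nval a s + nval b s"
| "nval (NSub a b) s = nval a s - nval b s"

fun rval :: "rexp \<Rightarrow> state \<Rightarrow> real" where
  "rval (RConst c) s = c"
| "rval (Mem a) s = mem s (nval a s)"
| "rval (Coord a) s = buf s (nval a s)"
| "rval (OfNat a) s = real (nval a s)"
| "rval (RAdd e f) s = rval e s + rval f s"
| "rval (RSub e f) s = rval e s - rval f s"
| "rval (RMul e f) s = rval e s * rval f s"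
| "rval (RDiv e f) s = rval e s / rval f s"

fun tval :: "test \<Rightarrow> state \<Rightarrow> bool" where
  "tval (NLess a b) s = (nval a s < nval b s)"
| "tval (RLess e f) s = (rval e s < rval f s)"
| "tval (RLe e f) s = (rval e s \<le> rval f s)"

fun ncost :: "nexp \<Rightarrow> nat" where
  "ncost (NConst k) = 1"
| "ncost (Reg r) = 1"
| "ncost (NAdd a b) = 1 + ncost a + ncost b"
| "ncost (NSub a b) = 1 + ncost a + ncost b"

fun rcost :: "rexp \<Rightarrow> nat" where
  "rcost (RConst c) = 1"
| "rcost (Mem a) = 1 + ncost a"
| "rcost (Coord a) = 1 + ncost a"
| "rcost (OfNat a) = 1 + ncost a"
| "rcost (RAdd e f) = 1 + rcost e + rcost f"
| "rcost (RSub e f) = 1 + rcost e + rcost f"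
| "rcost (RMul e f) = 1 + rcost e + rcost f"
| "rcost (RDiv e f) = 1 + rcost e + rcost f"

fun tcost :: "test \<Rightarrow> nat" where
  "tcost (NLess a b) = 1 + ncost a + ncost b"
| "tcost (RLess e f) = 1 + rcost e + rcost f"
| "tcost (RLe e f) = 1 + rcost e + rcost f"

text \<open>\<open>exec d \<omega> c s t s'\<close>: with sample sequence \<open>\<omega>\<close> in dimension \<open>d\<close>, command \<open>c\<close> started in state \<open>s\<close>
  terminates in state \<open>s'\<close> at cost \<open>t\<close>.\<close>

inductive exec ::
  "nat \<Rightarrow> (nat \<Rightarrow> nat \<Rightarrow> real) \<Rightarrow> com \<Rightarrow> state \<Rightarrow> nat \<Rightarrow> state \<Rightarrow> bool"
  for d :: nat and \<omega> :: "nat \<Rightarrow> nat \<Rightarrow> real" where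
  Skip: "exec d \<omega> Skip s 1 s"
| SetReg: "exec d \<omega> (SetReg r a) s (1 + ncost a) (s\<lparr>reg := (reg s)(r := nval a s)\<rparr>)"
| SetMem: "exec d \<omega> (SetMem a e) s (1 + ncost a + rcost e)
             (s\<lparr>mem := (mem s)(nval a s := rval e s)\<rparr>)"
| Draw: "exec d \<omega> Draw s (1 + d)
           (s\<lparr>buf := (\<lambda>j. if j < d then \<omega> (drawn s) j else 0), drawn := drawn s + 1\<rparr>)"
| Answer: "exec d \<omega> (Answer v) s 1 (s\<lparr>answer := Some v\<rparr>)"
| Seq: "exec d \<omega> c1 s t1 s1 \<Longrightarrow> exec d \<omega> c2 s1 t2 s2 \<Longrightarrow>
          exec d \<omega> (Seq c1 c2) s (t1 + t2) s2"
| CondTrue: "tval b s \<Longrightarrow> exec d \<omega> c1 s t s1 \<Longrightarrow> exec d \<omega> (Cond b c1 c2) s (1 + tcost b + t) s1"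
| CondFalse: "\<not> tval b s \<Longrightarrow> exec d \<omega> c2 s t s1 \<Longrightarrow> exec d \<omega> (Cond b c1 c2) s (1 + tcost b + t) s1"
| WhileFalse: "\<not> tval b s \<Longrightarrow> exec d \<omega> (While b c) s (1 + tcost b) s"
| WhileTrue: "tval b s \<Longrightarrow> exec d \<omega> c s t1 s1 \<Longrightarrow> exec d \<omega> (While b c) s1 t2 s2 \<Longrightarrow>
                exec d \<omega> (While b c) s (1 + tcost b + t1 + t2) s2"

text \<open>The inputs \<open>d\<close> and \<open>\<epsilon>\<close> are in register 0 and memory cell 0.\<close>

definition init_state :: "nat \<Rightarrow> real \<Rightarrow> state" where
  "init_state d \<epsilon> = \<lparr>reg = (\<lambda>_. 0)(0 := d), mem = (\<lambda>_. 0)(0 := \<epsilon>), buf = (\<lambda>_. 0),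
     drawn = 0, answer = None\<rparr>"

end

theory Submission
  imports Defs
begin

text \<open>Let \<open>W = (\<Sum>\<^sub>i X\<^sub>i)\<^sup>T (\<Sum>\<^sub>i Y\<^sub>i) = n\<^sup>2 Z\<close>. Under \<open>\<N>(0, I)\<close> independence of the two halves gives
  \<open>E[W\<^sup>2] = d n\<^sup>2\<close>, so Markov's inequality bounds the probability of \<open>W\<^sup>2 > 3 d n\<^sup>2\<close> by \<open>1/3\<close>.
  Under \<open>\<N>(\<mu>, S)\<close> the statistic \<open>Z\<close> is a quadratic polynomial in a standard Gaussian vector of
  dimension \<open>2 n d\<close>, and \<open>E[Z\<^sup>2] \<ge> (E Z)\<^sup>2 = \<parallel>\<mu>\<parallel>\<^sup>4\<close> whatever \<open>S\<close> is. Carbery--Wright with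
  \<open>\<alpha> = \<surd>(3 d) / (n \<parallel>\<mu>\<parallel>\<^sup>2)\<close> then shows that \<open>\<bar>Z\<bar> \<le> \<surd>(3 d) / n\<close> has probability at most \<open>1/3\<close>,
  the constant 25 in \<open>n\<close> leaving room for \<open>9 \<surd>3 \<le> 25\<close>.\<close>

section \<open>Moments under product measures\<close>

text \<open>Under a product measure the joint law of the coordinates is the product itself, and
  coordinate \<open>i\<close> has law \<open>M i\<close>. Independence is the coincidence of the
  joint law with the product of the marginals, a criterion used here for nonempty
  \<open>K\<close>.\<close>

lemma indep_vars_PiM_coordinates:
  assumes M: "\<And>i. i \<in> K \<Longrightarrow> prob_space (M i)" and "K \<noteq> {}"
  shows "prob_space.indep_vars (PiM K M) M (\<lambda>i \<omega>. \<omega> i) K"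
proof -
  interpret P: prob_space "PiM K M"
    by (intro prob_space_PiM M)
  have "distr (PiM K M) (PiM K M) (\<lambda>x. \<lambda>i\<in>K. x i) = distr (PiM K M) (PiM K M) (\<lambda>x. x)"
    by (intro distr_cong) (auto simp: space_PiM PiE_def extensional_restrict)
  also have "\<dots> = PiM K M"
    by (rule distr_id)
  also have "\<dots> = PiM K (\<lambda>i. distr (PiM K M) (M i) (\<lambda>\<omega>. \<omega> i))"
    by (intro PiM_cong refl distr_PiM_component[symmetric] M)
  finally show ?thesis
    by (subst P.indep_vars_iff_distr_eq_PiM'[OF \<open>K \<noteq> {}\<close>]) auto
qed

text \<open>Restrictions to disjoint index sets are independent, and the law of each restriction is
  the smaller product measure, so expectations factor. This is what separates the X half of the
  samples from the Y half.\<close>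

lemma
  fixes f h :: "('i \<Rightarrow> 'a) \<Rightarrow> real"
  assumes M: "\<And>i. prob_space (M i)"
    and K: "finite K" "I \<subseteq> K" "J \<subseteq> K" "I \<inter> J = {}" "K \<noteq> {}"
    and f: "integrable (PiM I M) f" and h: "integrable (PiM J M) h"
  shows integrable_PiM_mult_disjoint:
      "integrable (PiM K M) (\<lambda>\<omega>. f (restrict \<omega> I) * h (restrict \<omega> J))"
    and integral_PiM_mult_disjoint:
      "(\<integral>\<omega>. f (restrict \<omega> I) * h (restrict \<omega> J) \<partial>PiM K M) =
        (\<integral>\<omega>. f \<omega> \<partial>PiM I M) * (\<integral>\<omega>. h \<omega> \<partial>PiM J M)"
proof -
  interpret M: prob_space "M i" for i by (rule M)
  interpret product_prob_space M K by standard
  interpret P: prob_space "PiM K M"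
    by (intro prob_space_PiM M)
  have restrict: "integrable (PiM K M) (\<lambda>\<omega>. g (restrict \<omega> L))"
    "(\<integral>\<omega>. g (restrict \<omega> L) \<partial>PiM K M) = (\<integral>\<omega>. g \<omega> \<partial>PiM L M)"
    if L: "L \<subseteq> K" and g: "integrable (PiM L M) g" for L and g :: "('i \<Rightarrow> 'a) \<Rightarrow> real"
  proof -
    note eq = distr_restrict[OF L K(1)]
    have r: "(\<lambda>\<omega>. restrict \<omega> L) \<in> measurable (PiM K M) (PiM L M)"
      by (rule measurable_restrict_subset[OF L])
    show "integrable (PiM K M) (\<lambda>\<omega>. g (restrict \<omega> L))"
      by (rule integrable_distr[OF r]) (use g eq in simp)
    show "(\<integral>\<omega>. g (restrict \<omega> L) \<partial>PiM K M) = (\<integral>\<omega>. g \<omega> \<partial>PiM L M)"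
      using integral_distr[OF r borel_measurable_integrable[OF g]] by (simp add: eq[symmetric])
  qed
  have "P.indep_var (PiM I M) (\<lambda>\<omega>. restrict (\<lambda>i. \<omega> i) I) (PiM J M) (\<lambda>\<omega>. restrict (\<lambda>i. \<omega> i) J)"
    by (rule P.indep_var_restrict[OF indep_vars_PiM_coordinates[OF M K(5)] K(4,2,3)])
  then have "P.indep_var borel (f \<circ> (\<lambda>\<omega>. restrict (\<lambda>i. \<omega> i) I)) borel (h \<circ> (\<lambda>\<omega>. restrict (\<lambda>i. \<omega> i) J))"
    by (rule P.indep_var_compose) (use f h in auto)
  then have ind: "P.indep_var borel (\<lambda>\<omega>. f (restrict \<omega> I)) borel (\<lambda>\<omega>. h (restrict \<omega> J))"
    by (simp add: comp_def)
  show "integrable (PiM K M) (\<lambda>\<omega>. f (restrict \<omega> I) * h (restrict \<omega> J))"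
    by (rule P.indep_var_integrable[OF ind restrict(1)[OF K(2) f] restrict(1)[OF K(3) h]])
  show "(\<integral>\<omega>. f (restrict \<omega> I) * h (restrict \<omega> J) \<partial>PiM K M) =
        (\<integral>\<omega>. f \<omega> \<partial>PiM I M) * (\<integral>\<omega>. h \<omega> \<partial>PiM J M)"
    using P.indep_var_lebesgue_integral[OF ind restrict(1)[OF K(2) f] restrict(1)[OF K(3) h]]
    by (simp add: restrict(2) K f h)
qed

lemma
  fixes f :: "'a \<Rightarrow> real"
  assumes M: "\<And>i. prob_space (M i)" and a: "a \<in> K" and f: "integrable (M a) f"
  shows integrable_PiM_coordinate: "integrable (PiM K M) (\<lambda>\<omega>. f (\<omega> a))"
    and integral_PiM_coordinate: "(\<integral>\<omega>. f (\<omega> a) \<partial>PiM K M) = (\<integral>x. f x \<partial>M a)"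
proof -
  note eq = distr_PiM_component[of K M a, OF M a]
  have m: "(\<lambda>\<omega>. \<omega> a) \<in> measurable (PiM K M) (M a)"
    using a by measurable
  show "integrable (PiM K M) (\<lambda>\<omega>. f (\<omega> a))"
    by (rule integrable_distr[OF m]) (use f eq in simp)
  show "(\<integral>\<omega>. f (\<omega> a) \<partial>PiM K M) = (\<integral>x. f x \<partial>M a)"
    using integral_distr[OF m borel_measurable_integrable[OF f]] by (simp add: eq)
qed

lemma
  fixes f h :: "'a \<Rightarrow> real"
  assumes M: "\<And>i. prob_space (M i)" and K: "finite K" "a \<in> K" "b \<in> K" "a \<noteq> b"
    and f: "integrable (M a) f" and h: "integrable (M b) h"
  shows integrable_PiM_coordinates_mult: "integrable (PiM K M) (\<lambda>\<omega>. f (\<omega> a) * h (\<omega> b))"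
    and integral_PiM_coordinates_mult:
      "(\<integral>\<omega>. f (\<omega> a) * h (\<omega> b) \<partial>PiM K M) = (\<integral>x. f x \<partial>M a) * (\<integral>x. h x \<partial>M b)"
proof -
  have i: "integrable (PiM {a} M) (\<lambda>\<omega>. f (\<omega> a))" "integrable (PiM {b} M) (\<lambda>\<omega>. h (\<omega> b))"
    by (intro integrable_PiM_coordinate M f h singletonI)+
  have e: "(\<integral>\<omega>. f (\<omega> a) \<partial>PiM {a} M) = (\<integral>x. f x \<partial>M a)"
    "(\<integral>\<omega>. h (\<omega> b) \<partial>PiM {b} M) = (\<integral>x. h x \<partial>M b)"
    by (intro integral_PiM_coordinate M f h singletonI)+
  have K': "{a} \<subseteq> K" "{b} \<subseteq> K" "{a} \<inter> {b} = {}" "K \<noteq> {}"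
    using K by auto
  show "integrable (PiM K M) (\<lambda>\<omega>. f (\<omega> a) * h (\<omega> b))"
    using integrable_PiM_mult_disjoint[OF M K(1) K' i] by simp
  show "(\<integral>\<omega>. f (\<omega> a) * h (\<omega> b) \<partial>PiM K M) = (\<integral>x. f x \<partial>M a) * (\<integral>x. h x \<partial>M b)"
    using integral_PiM_mult_disjoint[OF M K(1) K' i] by (simp add: e)
qed

text \<open>After expanding the product, the diagonal index pairs each contribute E[f h], while the
  two samples of any other pair are independent and contribute E[f] E[h].\<close>

lemma
  fixes f h :: "'a \<Rightarrow> real"
  assumes p: "prob_space p" and K: "finite K"
    and f: "integrable p f" and h: "integrable p h" and fh: "integrable p (\<lambda>x. f x * h x)"
  shows integrable_iid_sum_mult:
      "integrable (\<Pi>\<^sub>M i\<in>K. p) (\<lambda>\<omega>. (\<Sum>a\<in>K. f (\<omega> a)) * (\<Sum>b\<in>K. h (\<omega> b)))"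
    and integral_iid_sum_mult:
      "(\<integral>\<omega>. (\<Sum>a\<in>K. f (\<omega> a)) * (\<Sum>b\<in>K. h (\<omega> b)) \<partial>(\<Pi>\<^sub>M i\<in>K. p)) =
        real (card K) * (\<integral>x. f x * h x \<partial>p) +
        real (card K) * (real (card K) - 1) * ((\<integral>x. f x \<partial>p) * (\<integral>x. h x \<partial>p))"
proof -
  \<comment> \<open>The value is written as the independent product plus a correction supported on
    \<open>b = a\<close>, so that the double sum collapses by evaluating a delta.\<close>
  have int: "integrable (\<Pi>\<^sub>M i\<in>K. p) (\<lambda>\<omega>. f (\<omega> a) * h (\<omega> b))"
    and val: "(\<integral>\<omega>. f (\<omega> a) * h (\<omega> b) \<partial>(\<Pi>\<^sub>M i\<in>K. p)) =
      (\<integral>x. f x \<partial>p) * (\<integral>x. h x \<partial>p) +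
      (if b = a then (\<integral>x. f x * h x \<partial>p) - (\<integral>x. f x \<partial>p) * (\<integral>x. h x \<partial>p) else 0)"
    if "a \<in> K" "b \<in> K" for a b
    using integrable_PiM_coordinate[of "\<lambda>_. p" a K "\<lambda>x. f x * h x"]
      integral_PiM_coordinate[of "\<lambda>_. p" a K "\<lambda>x. f x * h x"]
      integrable_PiM_coordinates_mult[of "\<lambda>_. p" K a b f h]
      integral_PiM_coordinates_mult[of "\<lambda>_. p" K a b f h] that assms
    by (cases "b = a"; simp)+
  show "integrable (\<Pi>\<^sub>M i\<in>K. p) (\<lambda>\<omega>. (\<Sum>a\<in>K. f (\<omega> a)) * (\<Sum>b\<in>K. h (\<omega> b)))"
    unfolding sum_product by (intro Bochner_Integration.integrable_sum int)
  have "(\<integral>\<omega>. (\<Sum>a\<in>K. f (\<omega> a)) * (\<Sum>b\<in>K. h (\<omega> b)) \<partial>(\<Pi>\<^sub>M i\<in>K. p)) =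
      (\<Sum>a\<in>K. \<Sum>b\<in>K. \<integral>\<omega>. f (\<omega> a) * h (\<omega> b) \<partial>(\<Pi>\<^sub>M i\<in>K. p))"
    unfolding sum_product
    by (subst Bochner_Integration.integral_sum,
        intro Bochner_Integration.integrable_sum int, assumption+,
        intro sum.cong refl Bochner_Integration.integral_sum int)
  also have "\<dots> = (\<Sum>a\<in>K. \<Sum>b\<in>K. (\<integral>x. f x \<partial>p) * (\<integral>x. h x \<partial>p) +
      (if b = a then (\<integral>x. f x * h x \<partial>p) - (\<integral>x. f x \<partial>p) * (\<integral>x. h x \<partial>p) else 0))"
    by (intro sum.cong refl val)
  also have "\<dots> = real (card K) * (\<integral>x. f x * h x \<partial>p) +
        real (card K) * (real (card K) - 1) * ((\<integral>x. f x \<partial>p) * (\<integral>x. h x \<partial>p))"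
    using K by (simp add: sum.distrib algebra_simps)
  finally show "(\<integral>\<omega>. (\<Sum>a\<in>K. f (\<omega> a)) * (\<Sum>b\<in>K. h (\<omega> b)) \<partial>(\<Pi>\<^sub>M i\<in>K. p)) = \<dots>" .
qed

text \<open>With \<open>X j\<close> the j-th coordinate function, \<open>T\<close> is n^2 Z. Its
  square is a sum over pairs j, k of a factor in the first n samples times a factor in the last n.
  The two factors are independent with equal expectations, computed by
  \<open>integral_iid_sum_mult\<close>; hence the square in the last formula.\<close>

lemma
  fixes X :: "'j \<Rightarrow> 'a \<Rightarrow> real"
  assumes p: "prob_space p" and J: "finite J"
    and X: "\<And>j. j \<in> J \<Longrightarrow> integrable p (X j)"
    and XX: "\<And>j k. j \<in> J \<Longrightarrow> k \<in> J \<Longrightarrow> integrable p (\<lambda>x. X j x * X k x)"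
    and n: "n > 0"
  defines "P \<equiv> \<Pi>\<^sub>M i\<in>{..<2 * n}. p"
    and "T \<equiv> \<lambda>\<omega>. \<Sum>j\<in>J. (\<Sum>i<n. X j (\<omega> i)) * (\<Sum>i<n. X j (\<omega> (n + i)))"
  shows integrable_two_sample: "integrable P T"
    and integral_two_sample: "(\<integral>\<omega>. T \<omega> \<partial>P) = (real n)\<^sup>2 * (\<Sum>j\<in>J. (\<integral>x. X j x \<partial>p)\<^sup>2)"
    and integrable_two_sample_sq: "integrable P (\<lambda>\<omega>. (T \<omega>)\<^sup>2)"
    and integral_two_sample_sq: "(\<integral>\<omega>. (T \<omega>)\<^sup>2 \<partial>P) =
      (\<Sum>j\<in>J. \<Sum>k\<in>J. (real n * (\<integral>x. X j x * X k x \<partial>p) +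
        real n * (real n - 1) * ((\<integral>x. X j x \<partial>p) * (\<integral>x. X k x \<partial>p)))\<^sup>2)"
proof -
  define A where "A = {..<n}"
  define B where "B = {n..<2 * n}"
  have shift: "(\<Sum>i<n. f (n + i)) = (\<Sum>b\<in>B. f b)" for f :: "nat \<Rightarrow> real"
    unfolding B_def mult_2 using sum.shift_bounds_nat_ivl[of f 0 n n]
    by (simp add: atLeast0LessThan add.commute)
  have fin: "finite A" "finite B" and card: "card A = n" "card B = n"
    by (auto simp: A_def B_def)
  have sub: "finite {..<2 * n}" "A \<subseteq> {..<2 * n}" "B \<subseteq> {..<2 * n}" "A \<inter> B = {}" "{..<2 * n} \<noteq> {}"
    using n by (auto simp: A_def B_def lessThan_empty_iff)
  note split = integrable_PiM_mult_disjoint[of "\<lambda>_. p", OF p sub]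
    integral_PiM_mult_disjoint[of "\<lambda>_. p", OF p sub]
  interpret p: prob_space p by (rule p)
  have S1: "integrable (\<Pi>\<^sub>M i\<in>K. p) (\<lambda>\<omega>. \<Sum>a\<in>K. X j (\<omega> a))"
    "(\<integral>\<omega>. (\<Sum>a\<in>K. X j (\<omega> a)) \<partial>(\<Pi>\<^sub>M i\<in>K. p)) = real (card K) * (\<integral>x. X j x \<partial>p)"
    if "j \<in> J" for j and K :: "nat set"
  proof -
    have i: "integrable (\<Pi>\<^sub>M i\<in>K. p) (\<lambda>\<omega>. X j (\<omega> a))" if "a \<in> K" for a
      using integrable_PiM_coordinate[of "\<lambda>_. p" a K "X j"] p that X[OF \<open>j \<in> J\<close>] by simp
    then show "integrable (\<Pi>\<^sub>M i\<in>K. p) (\<lambda>\<omega>. \<Sum>a\<in>K. X j (\<omega> a))"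
      by (intro Bochner_Integration.integrable_sum)
    show "(\<integral>\<omega>. (\<Sum>a\<in>K. X j (\<omega> a)) \<partial>(\<Pi>\<^sub>M i\<in>K. p)) = real (card K) * (\<integral>x. X j x \<partial>p)"
      using integral_PiM_coordinate[of "\<lambda>_. p" _ K "X j"] p X[OF \<open>j \<in> J\<close>] i
      by (simp add: Bochner_Integration.integral_sum)
  qed
  define R where "R j k = real n * (\<integral>x. X j x * X k x \<partial>p) +
        real n * (real n - 1) * ((\<integral>x. X j x \<partial>p) * (\<integral>x. X k x \<partial>p))" for j k
  have S2: "integrable (\<Pi>\<^sub>M i\<in>K. p) (\<lambda>\<omega>. (\<Sum>a\<in>K. X j (\<omega> a)) * (\<Sum>b\<in>K. X k (\<omega> b)))"
    "(\<integral>\<omega>. (\<Sum>a\<in>K. X j (\<omega> a)) * (\<Sum>b\<in>K. X k (\<omega> b)) \<partial>(\<Pi>\<^sub>M i\<in>K. p)) = R j k"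
    if "finite K" "card K = n" "j \<in> J" "k \<in> J" for j k and K :: "nat set"
    using integrable_iid_sum_mult[OF p \<open>finite K\<close> X[OF \<open>j \<in> J\<close>] X[OF \<open>k \<in> J\<close>] XX[OF that(3,4)]]
      integral_iid_sum_mult[OF p \<open>finite K\<close> X[OF \<open>j \<in> J\<close>] X[OF \<open>k \<in> J\<close>] XX[OF that(3,4)]] that
    by (simp_all add: R_def)
  have T: "T \<omega> = (\<Sum>j\<in>J. (\<Sum>a\<in>A. X j (\<omega> a)) * (\<Sum>b\<in>B. X j (\<omega> b)))" for \<omega>
    by (simp add: T_def A_def shift[of "\<lambda>b. X j (\<omega> b)" for j])
  have i1: "integrable P (\<lambda>\<omega>. (\<Sum>a\<in>A. X j (\<omega> a)) * (\<Sum>b\<in>B. X j (\<omega> b)))"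
    and e1: "(\<integral>\<omega>. (\<Sum>a\<in>A. X j (\<omega> a)) * (\<Sum>b\<in>B. X j (\<omega> b)) \<partial>P) =
      (real n)\<^sup>2 * (\<integral>x. X j x \<partial>p)\<^sup>2" if "j \<in> J" for j
    using split[OF S1(1)[OF that] S1(1)[OF that]] S1(2)[OF that, of A] S1(2)[OF that, of B]
    by (simp_all add: P_def card power2_eq_square mult_ac)
  show "integrable P T"
    unfolding T by (intro Bochner_Integration.integrable_sum i1)
  show "(\<integral>\<omega>. T \<omega> \<partial>P) = (real n)\<^sup>2 * (\<Sum>j\<in>J. (\<integral>x. X j x \<partial>p)\<^sup>2)"
    unfolding T by (simp add: Bochner_Integration.integral_sum i1 e1 flip: sum_distrib_left)
  have T2: "(T \<omega>)\<^sup>2 = (\<Sum>j\<in>J. \<Sum>k\<in>J. ((\<Sum>a\<in>A. X j (\<omega> a)) * (\<Sum>a\<in>A. X k (\<omega> a))) *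
      ((\<Sum>b\<in>B. X j (\<omega> b)) * (\<Sum>b\<in>B. X k (\<omega> b))))" for \<omega>
    unfolding T power2_eq_square sum_product[of _ J] by (intro sum.cong refl) (simp only: mult_ac)
  have i2: "integrable P (\<lambda>\<omega>. ((\<Sum>a\<in>A. X j (\<omega> a)) * (\<Sum>a\<in>A. X k (\<omega> a))) *
      ((\<Sum>b\<in>B. X j (\<omega> b)) * (\<Sum>b\<in>B. X k (\<omega> b))))"
    and e2: "(\<integral>\<omega>. ((\<Sum>a\<in>A. X j (\<omega> a)) * (\<Sum>a\<in>A. X k (\<omega> a))) *
      ((\<Sum>b\<in>B. X j (\<omega> b)) * (\<Sum>b\<in>B. X k (\<omega> b))) \<partial>P) = (R j k)\<^sup>2" if "j \<in> J" "k \<in> J" for j k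
    using split[OF S2(1)[OF fin(1) card(1) that] S2(1)[OF fin(2) card(2) that]]
      S2(2)[OF fin(1) card(1) that] S2(2)[OF fin(2) card(2) that]
    by (simp_all add: P_def power2_eq_square)
  show "integrable P (\<lambda>\<omega>. (T \<omega>)\<^sup>2)"
    unfolding T2 by (intro Bochner_Integration.integrable_sum i2)
  show "(\<integral>\<omega>. (T \<omega>)\<^sup>2 \<partial>P) = (\<Sum>j\<in>J. \<Sum>k\<in>J. (R j k)\<^sup>2)"
    unfolding T2 by (simp add: Bochner_Integration.integral_sum Bochner_Integration.integrable_sum i2 e2)
qed

section \<open>Gaussian vectors\<close>

lemma prob_space_std_normal: "prob_space (density lborel std_normal_density)"
  by (rule prob_space_normal_density) simp

lemma
  shows integrable_std_normal: "integrable (density lborel std_normal_density) (\<lambda>x. x)"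
    and integral_std_normal: "(\<integral>x. x \<partial>density lborel std_normal_density) = 0"
    and integrable_std_normal_sq: "integrable (density lborel std_normal_density) (\<lambda>x. x * x)"
    and integral_std_normal_sq: "(\<integral>x. x * x \<partial>density lborel std_normal_density) = 1"
  using integrable_std_normal_moment[of 1] integral_std_normal_moment_odd[of 0]
    integrable_std_normal_moment[of 2] integral_std_normal_moment_even[of 1]
  by (simp_all add: integrable_density integral_density power2_eq_square)

lemma prob_space_std_gaussian: "prob_space (std_gaussian m)"
  unfolding std_gaussian_def by (intro prob_space_PiM prob_space_std_normal)

lemma sets_std_gaussian [measurable_cong]: "sets (std_gaussian m) = sets (borel_vec m)"
  unfolding std_gaussian_def borel_vec_def by (intro sets_PiM_cong) auto

lemma measurable_borel_vec_coordinate [measurable]: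
  "i < d \<Longrightarrow> (\<lambda>x. x i) \<in> borel_measurable (borel_vec d)"
  unfolding borel_vec_def by measurable

lemma
  assumes "i < m"
  shows integrable_std_gaussian: "integrable (std_gaussian m) (\<lambda>g. g i)"
    and integral_std_gaussian: "(\<integral>g. g i \<partial>std_gaussian m) = 0"
  unfolding std_gaussian_def
  using assms integrable_PiM_coordinate[of "\<lambda>_. density lborel std_normal_density" i "{..<m}" "\<lambda>x. x"]
    integral_PiM_coordinate[of "\<lambda>_. density lborel std_normal_density" i "{..<m}" "\<lambda>x. x"]
  by (simp_all add: prob_space_std_normal integrable_std_normal integral_std_normal)

lemma
  assumes "i < m" "j < m"
  shows integrable_std_gaussian_mult: "integrable (std_gaussian m) (\<lambda>g. g i * g j)"
    and integral_std_gaussian_mult: "(\<integral>g. g i * g j \<partial>std_gaussian m) = id_matrix i j"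
  unfolding std_gaussian_def
  using assms
    integrable_PiM_coordinate[of "\<lambda>_. density lborel std_normal_density" i "{..<m}" "\<lambda>x. x * x"]
    integral_PiM_coordinate[of "\<lambda>_. density lborel std_normal_density" i "{..<m}" "\<lambda>x. x * x"]
    integrable_PiM_coordinates_mult[of "\<lambda>_. density lborel std_normal_density" "{..<m}" i j
      "\<lambda>x. x" "\<lambda>x. x"]
    integral_PiM_coordinates_mult[of "\<lambda>_. density lborel std_normal_density" "{..<m}" i j
      "\<lambda>x. x" "\<lambda>x. x"]
  by (cases "i = j"; simp add: id_matrix_def prob_space_std_normal integrable_std_normal
      integral_std_normal integrable_std_normal_sq integral_std_normal_sq)+

text \<open>Linear terms have mean zero and E[g k * g l] vanishes for distinct k and l, so of the
  expanded product only the constant and the diagonal of the quadratic part survive.\<close>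

lemma
  fixes a a' :: real and b b' :: "nat \<Rightarrow> real" and m :: nat
  defines "f \<equiv> \<lambda>g. a + (\<Sum>k<m. b k * g k)" and "h \<equiv> \<lambda>g. a' + (\<Sum>k<m. b' k * g k)"
  shows integrable_std_gaussian_affine: "integrable (std_gaussian m) f"
    and integral_std_gaussian_affine: "(\<integral>g. f g \<partial>std_gaussian m) = a"
    and integrable_std_gaussian_affine_mult: "integrable (std_gaussian m) (\<lambda>g. f g * h g)"
    and integral_std_gaussian_affine_mult:
      "(\<integral>g. f g * h g \<partial>std_gaussian m) = a * a' + (\<Sum>k<m. b k * b' k)"
proof -
  interpret prob_space "std_gaussian m" by (rule prob_space_std_gaussian)
  note int = Bochner_Integration.integrable_sum integrable_mult_right integrable_std_gaussian
    integrable_std_gaussian_mult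
  have lin: "integrable (std_gaussian m) (\<lambda>g. \<Sum>k<m. c k * g k)"
    "(\<integral>g. (\<Sum>k<m. c k * g k) \<partial>std_gaussian m) = 0" for c
  proof -
    show "integrable (std_gaussian m) (\<lambda>g. \<Sum>k<m. c k * g k)"
      by (intro int) simp
    have "(\<integral>g. (\<Sum>k<m. c k * g k) \<partial>std_gaussian m) = (\<Sum>k<m. \<integral>g. c k * g k \<partial>std_gaussian m)"
      by (intro Bochner_Integration.integral_sum int) simp
    also have "\<dots> = 0"
      by (intro sum.neutral ballI) (simp add: integral_std_gaussian)
    finally show "(\<integral>g. (\<Sum>k<m. c k * g k) \<partial>std_gaussian m) = 0" .
  qed
  have quad: "integrable (std_gaussian m) (\<lambda>g. \<Sum>k<m. \<Sum>l<m. b k * b' l * (g k * g l))"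
    "(\<integral>g. (\<Sum>k<m. \<Sum>l<m. b k * b' l * (g k * g l)) \<partial>std_gaussian m) = (\<Sum>k<m. b k * b' k)"
  proof -
    show "integrable (std_gaussian m) (\<lambda>g. \<Sum>k<m. \<Sum>l<m. b k * b' l * (g k * g l))"
      by (intro int) simp_all
    have "(\<integral>g. (\<Sum>k<m. \<Sum>l<m. b k * b' l * (g k * g l)) \<partial>std_gaussian m) =
        (\<Sum>k<m. \<integral>g. (\<Sum>l<m. b k * b' l * (g k * g l)) \<partial>std_gaussian m)"
      by (intro Bochner_Integration.integral_sum int) simp_all
    also have "\<dots> = (\<Sum>k<m. \<Sum>l<m. \<integral>g. b k * b' l * (g k * g l) \<partial>std_gaussian m)"
      by (intro sum.cong refl Bochner_Integration.integral_sum int) simp_all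
    also have "\<dots> = (\<Sum>k<m. \<Sum>l<m. if l = k then b k * b' l else 0)"
      by (intro sum.cong refl) (simp add: integral_std_gaussian_mult id_matrix_def)
    also have "\<dots> = (\<Sum>k<m. b k * b' k)"
      by simp
    finally show "(\<integral>g. (\<Sum>k<m. \<Sum>l<m. b k * b' l * (g k * g l)) \<partial>std_gaussian m) = \<dots>" .
  qed
  note [simp] = lin quad Bochner_Integration.integral_add prob_space
  have fh: "f g * h g = a * a' + ((\<Sum>k<m. a * b' k * g k) + ((\<Sum>k<m. a' * b k * g k) +
      (\<Sum>k<m. \<Sum>l<m. b k * b' l * (g k * g l))))" for g
  proof -
    have "f g * h g = a * a' + (a * (\<Sum>k<m. b' k * g k) + (a' * (\<Sum>k<m. b k * g k) +
        (\<Sum>k<m. b k * g k) * (\<Sum>k<m. b' k * g k)))"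
      by (simp add: f_def h_def algebra_simps)
    then show ?thesis
      unfolding sum_product unfolding sum_distrib_left by (simp only: mult_ac)
  qed
  show "integrable (std_gaussian m) f" "(\<integral>g. f g \<partial>std_gaussian m) = a"
    unfolding f_def by simp_all
  show "integrable (std_gaussian m) (\<lambda>g. f g * h g)"
    unfolding fh by simp
  show "(\<integral>g. f g * h g \<partial>std_gaussian m) = a * a' + (\<Sum>k<m. b k * b' k)"
    unfolding fh by simp
qed

section \<open>Laws of affine images of a standard Gaussian\<close>

definition affine_image :: "nat \<Rightarrow> (nat \<Rightarrow> real) \<Rightarrow> (nat \<Rightarrow> nat \<Rightarrow> real) \<Rightarrow> (nat \<Rightarrow> real) \<Rightarrow> nat \<Rightarrow> real" where
  "affine_image d \<mu> A g = (\<lambda>i\<in>{..<d}. \<mu> i + (\<Sum>k<d. A i k * g k))"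

lemma measurable_affine_image [measurable]:
  "affine_image d \<mu> A \<in> measurable (borel_vec d) (borel_vec d)"
  unfolding affine_image_def borel_vec_def by measurable

lemma
  fixes \<mu> :: "nat \<Rightarrow> real" and A :: "nat \<Rightarrow> nat \<Rightarrow> real" and d :: nat
  defines "p \<equiv> distr (std_gaussian d) (borel_vec d) (affine_image d \<mu> A)"
  shows prob_space_affine_image: "prob_space p"
    and integrable_affine_image: "i < d \<Longrightarrow> integrable p (\<lambda>x. x i)"
    and integral_affine_image: "i < d \<Longrightarrow> (\<integral>x. x i \<partial>p) = \<mu> i"
    and integrable_affine_image_mult: "i < d \<Longrightarrow> j < d \<Longrightarrow> integrable p (\<lambda>x. x i * x j)"
    and integral_affine_image_mult: "i < d \<Longrightarrow> j < d \<Longrightarrow>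
      (\<integral>x. x i * x j \<partial>p) = \<mu> i * \<mu> j + (\<Sum>k<d. A i k * A j k)"
proof -
  have T [measurable]: "affine_image d \<mu> A \<in> measurable (std_gaussian d) (borel_vec d)"
    by measurable
  show "prob_space p"
    unfolding p_def by (rule prob_space.prob_space_distr[OF prob_space_std_gaussian T])
  have coord: "affine_image d \<mu> A g i = \<mu> i + (\<Sum>k<d. A i k * g k)" if "i < d" for g i
    using that by (simp add: affine_image_def)
  show "integrable p (\<lambda>x. x i)" "(\<integral>x. x i \<partial>p) = \<mu> i" if "i < d"
    using that integrable_std_gaussian_affine integral_std_gaussian_affine
    by (simp_all add: p_def integrable_distr_eq[OF T] integral_distr[OF T] coord)
  show "integrable p (\<lambda>x. x i * x j)"
    "(\<integral>x. x i * x j \<partial>p) = \<mu> i * \<mu> j + (\<Sum>k<d. A i k * A j k)" if "i < d" "j < d"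
    using that integrable_std_gaussian_affine_mult integral_std_gaussian_affine_mult
    by (simp_all add: p_def integrable_distr_eq[OF T] integral_distr[OF T] coord)
qed

lemma gaussian_eq_affine_image:
  "gaussian d \<mu> S p \<longleftrightarrow> (\<exists>A. (\<forall>i<d. \<forall>j<d. S i j = (\<Sum>k<d. A i k * A j k)) \<and>
     p = distr (std_gaussian d) (borel_vec d) (affine_image d \<mu> A))"
  unfolding gaussian_def affine_image_def ..

lemma block_index_less:
  fixes b d k N :: nat
  assumes "b < N" "k < d"
  shows "b * d + k < N * d"
proof -
  have "b * d + k < Suc b * d" using assms by simp
  also have "\<dots> \<le> N * d" using assms by (intro mult_right_mono) auto
  finally show ?thesis .
qed

text \<open>Splitting one standard Gaussian vector of dimension \<open>N d\<close> into \<open>N\<close> blocks realises all samples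
  as a function of a single Gaussian, which is what Carbery--Wright needs.\<close>

lemma
  fixes \<mu> :: "nat \<Rightarrow> real" and A :: "nat \<Rightarrow> nat \<Rightarrow> real" and d :: nat
  defines "\<Phi> N \<equiv> \<lambda>g. \<lambda>b\<in>{..<N}. affine_image d \<mu> A (\<lambda>k. g (b * d + k))"
  assumes N: "N > 0" and d: "d > 0"
  shows measurable_iid_affine_image:
      "\<Phi> N \<in> measurable (std_gaussian (N * d)) (\<Pi>\<^sub>M i\<in>{..<N}. borel_vec d)"
    and iid_affine_image_eq_distr: "(\<Pi>\<^sub>M i\<in>{..<N}. distr (std_gaussian d) (borel_vec d) (affine_image d \<mu> A)) =
      distr (std_gaussian (N * d)) (\<Pi>\<^sub>M i\<in>{..<N}. borel_vec d) (\<Phi> N)"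
proof -
  define B where "B b = {b * d..<b * d + d}" for b
  define X where "X b g = affine_image d \<mu> A (\<lambda>k. g (b * d + k))" for b and g :: "nat \<Rightarrow> real"
  interpret G: prob_space "std_gaussian (N * d)" by (rule prob_space_std_gaussian)
  note le = block_index_less[of _ N _ d]
  \<comment> \<open>Measurability on block \<open>B b\<close> alone records that sample
    \<open>b\<close> reads only its own coordinates; independence of the blocks then passes to the
    samples.\<close>
  have X_meas: "X b \<in> measurable (\<Pi>\<^sub>M i\<in>B b. borel) (borel_vec d)" for b
    unfolding X_def affine_image_def borel_vec_def B_def by measurable
  have X_rv [measurable]: "X b \<in> measurable (std_gaussian (N * d)) (borel_vec d)" if "b < N" for b
    unfolding X_def affine_image_def measurable_cong_sets[OF sets_std_gaussian refl]
    unfolding borel_vec_def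
    by (intro measurable_restrict borel_measurable_add borel_measurable_sum borel_measurable_times
        borel_measurable_const measurable_component_singleton) (use le[OF that] in auto)
  show "\<Phi> N \<in> measurable (std_gaussian (N * d)) (\<Pi>\<^sub>M i\<in>{..<N}. borel_vec d)"
    unfolding \<Phi>_def by (intro measurable_restrict) (simp add: X_rv[unfolded X_def])
  have "G.indep_vars (\<lambda>_. density lborel std_normal_density) (\<lambda>i g. g i) {..<N * d}"
    unfolding std_gaussian_def
    by (rule indep_vars_PiM_coordinates) (use N d in \<open>auto simp: prob_space_std_normal lessThan_empty_iff\<close>)
  then have "G.indep_vars (\<lambda>b. PiM (B b) (\<lambda>_. density lborel std_normal_density))
      (\<lambda>b g. restrict (\<lambda>i. g i) (B b)) {..<N}"
  proof (rule G.indep_vars_restrict)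
    show "B b \<subseteq> {..<N * d}" if "b \<in> {..<N}" for b
      using le[of b] that by (force simp: B_def le_iff_add)
    \<comment> \<open>The block containing x is recovered as x div d, so distinct blocks do not
      meet.\<close>
    have "b = b'" if "x \<in> B b" "x \<in> B b'" for x b b'
    proof -
      have "x div d = b" if "x \<in> B b" for b
        using that d by (intro div_nat_eqI) (auto simp: B_def algebra_simps)
      with that show ?thesis by metis
    qed
    then show "disjoint_family_on B {..<N}"
      by (auto simp: disjoint_family_on_def)
  qed
  then have "G.indep_vars (\<lambda>_. borel_vec d) (\<lambda>b. X b \<circ> (\<lambda>g. restrict (\<lambda>i. g i) (B b))) {..<N}"
    by (rule G.indep_vars_compose) (use X_meas in \<open>simp cong: measurable_cong_sets sets_PiM_cong\<close>)
  also have "(\<lambda>b. X b \<circ> (\<lambda>g. restrict (\<lambda>i. g i) (B b))) = X"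
    by (auto simp: fun_eq_iff X_def affine_image_def B_def intro!: sum.cong)
  finally have "distr (std_gaussian (N * d)) (\<Pi>\<^sub>M i\<in>{..<N}. borel_vec d) (\<Phi> N) =
      (\<Pi>\<^sub>M b\<in>{..<N}. distr (std_gaussian (N * d)) (borel_vec d) (X b))"
    using N by (subst (asm) G.indep_vars_iff_distr_eq_PiM') (auto simp: X_rv \<Phi>_def X_def lessThan_empty_iff)
  also have "\<dots> = (\<Pi>\<^sub>M b\<in>{..<N}. distr (std_gaussian d) (borel_vec d) (affine_image d \<mu> A))"
  proof (intro PiM_cong refl)
    fix b assume "b \<in> {..<N}"
    then have b: "b < N" by simp
    \<comment> \<open>Moving block b down to the indices below d turns the large Gaussian into a
      standard one of dimension d, so all samples have the same law.\<close>
    define r where "r g = (\<lambda>k\<in>{..<d}. g (b * d + k))" for g :: "nat \<Rightarrow> real"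
    have eq: "distr (std_gaussian (N * d)) (std_gaussian d) r = std_gaussian d"
      unfolding std_gaussian_def r_def
      using le[OF b] by (intro distr_PiM_reindex prob_space_std_normal) (auto intro: inj_onI)
    have r: "r \<in> measurable (std_gaussian (N * d)) (std_gaussian d)"
      unfolding std_gaussian_def r_def
      by (intro measurable_restrict measurable_component_singleton) (use le[OF b] in auto)
    have "distr (std_gaussian d) (borel_vec d) (affine_image d \<mu> A) =
        distr (std_gaussian (N * d)) (borel_vec d) (affine_image d \<mu> A \<circ> r)"
      by (subst (1) eq[symmetric], subst distr_distr) (simp_all add: r)
    also have "affine_image d \<mu> A \<circ> r = X b"
      by (simp add: fun_eq_iff X_def r_def affine_image_def)
    finally show "distr (std_gaussian (N * d)) (borel_vec d) (X b) =
        distr (std_gaussian d) (borel_vec d) (affine_image d \<mu> A)" ..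
  qed
  finally show "(\<Pi>\<^sub>M i\<in>{..<N}. distr (std_gaussian d) (borel_vec d) (affine_image d \<mu> A)) =
      distr (std_gaussian (N * d)) (\<Pi>\<^sub>M i\<in>{..<N}. borel_vec d) (\<Phi> N)" ..
qed

section \<open>Quadratic polynomials\<close>

text \<open>Each coordinate of each sample is affine in the underlying Gaussian vector. The closure
  lemmas below let \<open>soundness\<close> recognise the statistic as \<open>quadratic\<close> from
  its shape, without exhibiting coefficients.\<close>

definition affine_form :: "nat \<Rightarrow> ((nat \<Rightarrow> real) \<Rightarrow> real) \<Rightarrow> bool" where
  "affine_form m f \<longleftrightarrow> (\<exists>a b. \<forall>x. f x = a + (\<Sum>i<m. b i * x i))"

lemma affine_form_const: "affine_form m (\<lambda>_. a)"
  unfolding affine_form_def by (rule exI[of _ a], rule exI[of _ "\<lambda>_. 0"]) simp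

lemma affine_form_coordinate: "i < m \<Longrightarrow> affine_form m (\<lambda>x. x i)"
  unfolding affine_form_def
  by (rule exI[of _ 0], rule exI[of _ "\<lambda>j. if j = i then 1 else 0"])
     (simp add: if_distrib[of "\<lambda>a. a * _"] cong: if_cong)

lemma affine_form_add:
  assumes "affine_form m f" "affine_form m h"
  shows "affine_form m (\<lambda>x. f x + h x)"
proof -
  from assms obtain a b a' b' where "\<And>x. f x = a + (\<Sum>i<m. b i * x i)"
    "\<And>x. h x = a' + (\<Sum>i<m. b' i * x i)"
    unfolding affine_form_def by metis
  then have "\<forall>x. f x + h x = (a + a') + (\<Sum>i<m. (b i + b' i) * x i)"
    by (simp add: distrib_right sum.distrib)
  then show ?thesis
    unfolding affine_form_def by (intro exI[of _ "a + a'"] exI[of _ "\<lambda>i. b i + b' i"])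
qed

lemma affine_form_cmult:
  assumes "affine_form m f"
  shows "affine_form m (\<lambda>x. c * f x)"
proof -
  from assms obtain a b where "\<And>x. f x = a + (\<Sum>i<m. b i * x i)"
    unfolding affine_form_def by metis
  then have "\<forall>x. c * f x = c * a + (\<Sum>i<m. (c * b i) * x i)"
    by (simp add: distrib_left sum_distrib_left mult.assoc)
  then show ?thesis
    unfolding affine_form_def by (intro exI[of _ "c * a"] exI[of _ "\<lambda>i. c * b i"])
qed

lemma affine_form_sum:
  "(\<And>i. i \<in> I \<Longrightarrow> affine_form m (f i)) \<Longrightarrow> affine_form m (\<lambda>x. \<Sum>i\<in>I. f i x)"
  by (induction I rule: infinite_finite_induct) (simp_all add: affine_form_const affine_form_add)

lemma quadratic_affine_mult:
  assumes "affine_form m f" "affine_form m h"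
  shows "quadratic m (\<lambda>x. f x * h x)"
proof -
  from assms obtain a b a' b' where f: "\<And>x. f x = a + (\<Sum>i<m. b i * x i)"
    and h: "\<And>x. h x = a' + (\<Sum>i<m. b' i * x i)"
    unfolding affine_form_def by metis
  have "f x * h x = a * a' + (\<Sum>i<m. (a * b' i + a' * b i) * x i)
      + (\<Sum>i<m. \<Sum>j<m. (b i * b' j) * x i * x j)" for x
  proof -
    have "f x * h x = a * a' + (a * (\<Sum>i<m. b' i * x i) + a' * (\<Sum>i<m. b i * x i)) +
        (\<Sum>i<m. b i * x i) * (\<Sum>i<m. b' i * x i)"
      by (simp add: f h algebra_simps)
    then show ?thesis
      unfolding sum_product unfolding sum_distrib_left sum.distrib[symmetric]
      by (simp only: distrib_left distrib_right mult_ac)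
  qed
  then show ?thesis
    unfolding quadratic_def
    by (intro exI[of _ "a * a'"] exI[of _ "\<lambda>i. a * b' i + a' * b i"] exI[of _ "\<lambda>i j. b i * b' j"]) simp
qed

lemma quadratic_cmult:
  assumes "quadratic m q"
  shows "quadratic m (\<lambda>x. c * q x)"
proof -
  from assms obtain a b u where
    "\<And>x. q x = a + (\<Sum>i<m. b i * x i) + (\<Sum>i<m. \<Sum>j<m. u i j * x i * x j)"
    unfolding quadratic_def by blast
  then have "\<forall>x. c * q x = c * a + (\<Sum>i<m. (c * b i) * x i) + (\<Sum>i<m. \<Sum>j<m. (c * u i j) * x i * x j)"
    by (simp add: distrib_left sum_distrib_left mult.assoc)
  then show ?thesis
    unfolding quadratic_def
    by (intro exI[of _ "c * a"] exI[of _ "\<lambda>i. c * b i"] exI[of _ "\<lambda>i j. c * u i j"])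
qed

lemma quadratic_add:
  assumes "quadratic m q" "quadratic m q'"
  shows "quadratic m (\<lambda>x. q x + q' x)"
proof -
  obtain a b u where
    q: "\<And>x. q x = a + (\<Sum>i<m. b i * x i) + (\<Sum>i<m. \<Sum>j<m. u i j * x i * x j)"
    using assms(1) unfolding quadratic_def by blast
  obtain a' b' u' where
    q': "\<And>x. q' x = a' + (\<Sum>i<m. b' i * x i) + (\<Sum>i<m. \<Sum>j<m. u' i j * x i * x j)"
    using assms(2) unfolding quadratic_def by blast
  have "\<forall>x. q x + q' x = (a + a') + (\<Sum>i<m. (b i + b' i) * x i)
      + (\<Sum>i<m. \<Sum>j<m. (u i j + u' i j) * x i * x j)"
    by (simp add: q q' distrib_right sum.distrib)
  then show ?thesis
    unfolding quadratic_def
    by (intro exI[of _ "a + a'"] exI[of _ "\<lambda>i. b i + b' i"] exI[of _ "\<lambda>i j. u i j + u' i j"])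
qed

lemma quadratic_sum:
  "(\<And>i. i \<in> I \<Longrightarrow> quadratic m (q i)) \<Longrightarrow> quadratic m (\<lambda>x. \<Sum>i\<in>I. q i x)"
proof (induction I rule: infinite_finite_induct)
  \<comment> \<open>The zero polynomial covers the empty index set and also infinite ones, over
    which a sum is 0 by convention.\<close>
  have "quadratic m (\<lambda>_. 0)"
    using quadratic_affine_mult[OF affine_form_const[of m 0] affine_form_const[of m 0]] by simp
  then show "quadratic m (\<lambda>x. \<Sum>i\<in>{}. q i x)"
    "\<And>A. infinite A \<Longrightarrow> quadratic m (\<lambda>x. \<Sum>i\<in>A. q i x)"
    by simp_all
qed (simp add: quadratic_add)

section \<open>A real-RAM implementation\<close>

text \<open>Total correctness: a terminating run must exist. \<open>T\<close> only bounds its cost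
  from above, so every phase can be charged a round multiple of its parameters.\<close>

definition triple ::
  "nat \<Rightarrow> (nat \<Rightarrow> nat \<Rightarrow> real) \<Rightarrow> (state \<Rightarrow> bool) \<Rightarrow> com \<Rightarrow> nat \<Rightarrow> (state \<Rightarrow> bool) \<Rightarrow> bool" where
  "triple d \<omega> P c T Q \<longleftrightarrow> (\<forall>s. P s \<longrightarrow> (\<exists>t s'. exec d \<omega> c s t s' \<and> t \<le> T \<and> Q s'))"

lemma triple_SetReg:
  "(\<And>s. P s \<Longrightarrow> Q (s\<lparr>reg := (reg s)(r := nval a s)\<rparr>)) \<Longrightarrow> 1 + ncost a \<le> T \<Longrightarrow>
    triple d \<omega> P (SetReg r a) T Q"
  unfolding triple_def by (blast intro: exec.SetReg)

lemma triple_SetMem: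
  "(\<And>s. P s \<Longrightarrow> Q (s\<lparr>mem := (mem s)(nval a s := rval e s)\<rparr>)) \<Longrightarrow> 1 + ncost a + rcost e \<le> T \<Longrightarrow>
    triple d \<omega> P (SetMem a e) T Q"
  unfolding triple_def by (blast intro: exec.SetMem)

lemma triple_Draw:
  "(\<And>s. P s \<Longrightarrow>
      Q (s\<lparr>buf := (\<lambda>j. if j < d then \<omega> (drawn s) j else 0), drawn := drawn s + 1\<rparr>)) \<Longrightarrow>
    1 + d \<le> T \<Longrightarrow> triple d \<omega> P Draw T Q"
  unfolding triple_def by (blast intro: exec.Draw)

lemma triple_Answer:
  "(\<And>s. P s \<Longrightarrow> Q (s\<lparr>answer := Some v\<rparr>)) \<Longrightarrow> 1 \<le> T \<Longrightarrow> triple d \<omega> P (Answer v) T Q"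
  unfolding triple_def by (blast intro: exec.Answer)

lemma triple_Seq:
  assumes "triple d \<omega> P c1 T1 Q" "triple d \<omega> Q c2 T2 R" "T1 + T2 \<le> T"
  shows "triple d \<omega> P (Seq c1 c2) T R"
  unfolding triple_def
proof (intro allI impI)
  fix s assume "P s"
  then obtain t1 s1 where 1: "exec d \<omega> c1 s t1 s1" "t1 \<le> T1" "Q s1"
    using assms(1) unfolding triple_def by blast
  then obtain t2 s2 where 2: "exec d \<omega> c2 s1 t2 s2" "t2 \<le> T2" "R s2"
    using assms(2) unfolding triple_def by blast
  have "t1 + t2 \<le> T"
    using 1 2 assms(3) by simp
  with exec.Seq[OF 1(1) 2(1)] 2(3)
  show "\<exists>t s'. exec d \<omega> (Seq c1 c2) s t s' \<and> t \<le> T \<and> R s'"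
    by blast
qed

lemma triple_Cond:
  assumes "triple d \<omega> (\<lambda>s. P s \<and> tval b s) c1 T1 Q" "triple d \<omega> (\<lambda>s. P s \<and> \<not> tval b s) c2 T1 Q"
    and "1 + tcost b + T1 \<le> T"
  shows "triple d \<omega> P (Cond b c1 c2) T Q"
  unfolding triple_def
proof (intro allI impI)
  fix s assume P: "P s"
  have *: "1 + tcost b + t \<le> T" if "t \<le> T1" for t
    using that assms(3) by simp
  show "\<exists>t s'. exec d \<omega> (Cond b c1 c2) s t s' \<and> t \<le> T \<and> Q s'"
  proof (cases "tval b s")
    case True
    then show ?thesis
      using assms(1) P * unfolding triple_def by (meson exec.CondTrue)
  next
    case False
    then show ?thesis
      using assms(2) P * unfolding triple_def by (meson exec.CondFalse)
  qed
qed

text \<open>The invariant is indexed by the number of completed rounds. There are N bodies and N + 1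
  tests, the failing one included. The induction goes down from N, adding one round in front at each
  step.\<close>

lemma triple_While:
  assumes step: "\<And>k. k < N \<Longrightarrow> triple d \<omega> (I k) c B (I (Suc k))"
    and continue: "\<And>k s. k < N \<Longrightarrow> I k s \<Longrightarrow> tval b s"
    and stop: "\<And>s. I N s \<Longrightarrow> \<not> tval b s"
    and T: "N * (1 + tcost b + B) + (1 + tcost b) \<le> T"
  shows "triple d \<omega> (I 0) (While b c) T (I N)"
proof -
  have "triple d \<omega> (I k) (While b c) ((N - k) * (1 + tcost b + B) + (1 + tcost b)) (I N)"
    if "k \<le> N" for k
    using that
  proof (induction rule: inc_induct)
    case base
    then show ?case
      unfolding triple_def using stop exec.WhileFalse by fastforce
  next
    case (step k)
    show ?case
      unfolding triple_def
    proof (intro allI impI)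
      fix s assume I: "I k s"
      obtain t1 s1 where 1: "exec d \<omega> c s t1 s1" "t1 \<le> B" "I (Suc k) s1"
        using assms(1)[OF step.hyps(2)] I unfolding triple_def by blast
      obtain t2 s2 where 2: "exec d \<omega> (While b c) s1 t2 s2"
        "t2 \<le> (N - Suc k) * (1 + tcost b + B) + (1 + tcost b)" "I N s2"
        using step.IH 1(3) unfolding triple_def by blast
      have "N - k = Suc (N - Suc k)"
        using step.hyps(2) by simp
      then have "1 + tcost b + t1 + t2 \<le> (N - k) * (1 + tcost b + B) + (1 + tcost b)"
        using 1(2) 2(2) by simp
      with exec.WhileTrue[OF continue[OF step.hyps(2) I] 1(1) 2(1)] 2(3)
      show "\<exists>t s'. exec d \<omega> (While b c) s t s' \<and>
          t \<le> (N - k) * (1 + tcost b + B) + (1 + tcost b) \<and> I N s'"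
        by blast
    qed
  qed
  from this[of 0] T show ?thesis
    unfolding triple_def by (metis diff_zero le_trans zero_le)
qed

lemma triple_conseq:
  assumes "triple d \<omega> P c T Q" "\<And>s. P' s \<Longrightarrow> P s" "\<And>s. Q s \<Longrightarrow> Q' s" "T \<le> T'"
  shows "triple d \<omega> P' c T' Q'"
  using assms unfolding triple_def by (meson le_trans)

text \<open>Register 1 holds \<open>n\<close>, registers 2 and 3 are loop counters. Memory cells
  \<open>1, \<dots>, d\<close> accumulate \<open>\<Sum>\<^sub>i X\<^sub>i\<close>, the next \<open>d\<close> cells \<open>\<Sum>\<^sub>i Y\<^sub>i\<close>, and cell \<open>2 d + 1\<close> their inner product \<open>W\<close>.
  As the machine has no square root, \<open>n \<ge> 25 C\<^sup>2 \<surd>d / \<epsilon>\<^sup>2\<close> is tested as \<open>n\<^sup>2 \<epsilon>\<^sup>4 \<ge> 625 C\<^sup>4 d\<close>, and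
  \<open>\<bar>Z\<bar> \<le> \<surd>(3 d) / n\<close> as \<open>W\<^sup>2 \<le> 3 d n\<^sup>2\<close>.\<close>

definition find_n :: "real \<Rightarrow> com" where
  "find_n C = While
     (RLess (RMul (RMul (OfNat (Reg 1)) (OfNat (Reg 1)))
                  (RMul (RMul (Mem (NConst 0)) (Mem (NConst 0))) (RMul (Mem (NConst 0)) (Mem (NConst 0)))))
            (RMul (RConst (625 * C ^ 4)) (OfNat (Reg 0))))
     (SetReg 1 (NAdd (Reg 1) (NConst 1)))"

text \<open>The offset is \<open>NConst 0\<close> for the accumulators of the X samples and
  \<open>Reg 0\<close>, that is d, for those of the Y samples, so the same code serves both. The
  leading 1 skips cell 0, which holds \<epsilon>.\<close>

definition cell :: "nexp \<Rightarrow> nexp" where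
  "cell off = NAdd (NAdd (NConst 1) off) (Reg 3)"

definition add_sample :: "nexp \<Rightarrow> com" where
  "add_sample off = Seq Draw (Seq (SetReg 3 (NConst 0)) (Seq
     (While (NLess (Reg 3) (Reg 0))
       (Seq (SetMem (cell off) (RAdd (Mem (cell off)) (Coord (Reg 3))))
            (SetReg 3 (NAdd (Reg 3) (NConst 1)))))
     (SetReg 2 (NAdd (Reg 2) (NConst 1)))))"

definition add_samples :: "nexp \<Rightarrow> com" where
  "add_samples off = Seq (SetReg 2 (NConst 0)) (While (NLess (Reg 2) (Reg 1)) (add_sample off))"

definition inner_product :: com where
  "inner_product = Seq (SetReg 3 (NConst 0)) (While (NLess (Reg 3) (Reg 0))
     (Seq (SetMem (NAdd (NConst 1) (NAdd (Reg 0) (Reg 0)))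
             (RAdd (Mem (NAdd (NConst 1) (NAdd (Reg 0) (Reg 0))))
                   (RMul (Mem (cell (NConst 0))) (Mem (cell (Reg 0))))))
          (SetReg 3 (NAdd (Reg 3) (NConst 1)))))"

definition decide :: com where
  "decide = Cond
     (RLe (RMul (Mem (NAdd (NConst 1) (NAdd (Reg 0) (Reg 0)))) (Mem (NAdd (NConst 1) (NAdd (Reg 0) (Reg 0)))))
          (RMul (RMul (RConst 3) (OfNat (Reg 0))) (RMul (OfNat (Reg 1)) (OfNat (Reg 1)))))
     (Answer ACCEPT) (Answer REJECT)"

definition tester_program :: "real \<Rightarrow> com" where
  "tester_program C = Seq (find_n C) (Seq (add_samples (NConst 0)) (Seq (add_samples (Reg 0))
     (Seq inner_product decide)))"

section \<open>Positivity of the sample size and root-free forms of the two comparisons\<close>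

lemma sample_num_pos:
  assumes "0 < C" "d \<ge> 1" "0 < \<epsilon>"
  shows "sample_num C d \<epsilon> \<ge> 1"
proof -
  have "0 < 25 * C\<^sup>2 * sqrt (real d) / \<epsilon>\<^sup>2"
    using assms by simp
  then show ?thesis
    unfolding sample_num_def by linarith
qed

text \<open>A natural number lies below a ceiling iff it lies below the number itself. Clearing the
  denominator and squaring two nonnegative sides then removes the square root, which gives the test
  of \<open>find_n\<close>.\<close>

lemma less_sample_num_iff:
  assumes "0 < C" "d \<ge> 1" "0 < \<epsilon>"
  shows "k < sample_num C d \<epsilon> \<longleftrightarrow> (real k)\<^sup>2 * \<epsilon> ^ 4 < 625 * C ^ 4 * real d"
proof -
  have "k < sample_num C d \<epsilon> \<longleftrightarrow> real k < 25 * C\<^sup>2 * sqrt (real d) / \<epsilon>\<^sup>2"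
    unfolding sample_num_def by linarith
  also have "\<dots> \<longleftrightarrow> real k * \<epsilon>\<^sup>2 < 25 * C\<^sup>2 * sqrt (real d)"
    using assms by (simp add: pos_less_divide_eq)
  also have "\<dots> \<longleftrightarrow> (real k * \<epsilon>\<^sup>2)\<^sup>2 < (25 * C\<^sup>2 * sqrt (real d))\<^sup>2"
    using assms by (intro iffI power_strict_mono) (auto dest: power2_less_imp_less)
  also have "\<dots> \<longleftrightarrow> (real k)\<^sup>2 * \<epsilon> ^ 4 < 625 * C ^ 4 * real d"
    by (simp add: power_mult_distrib flip: power_mult)
  finally show ?thesis .
qed

text \<open>Since W = n^2 Z, multiplying by n^2 and squaring turns the acceptance test into a
  comparison of polynomials, which \<open>decide\<close> evaluates and to which Markov's inequality
  applies.\<close>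

lemma abs_statistic_le_iff:
  fixes d :: nat
  assumes "n \<ge> 1"
  defines "W \<equiv> \<lambda>\<omega>. \<Sum>j<d. (\<Sum>i<n. \<omega> i j) * (\<Sum>i<n. \<omega> (n + i) j)"
  shows "\<bar>statistic d n \<omega>\<bar> \<le> sqrt (3 * real d) / real n \<longleftrightarrow> (W \<omega>)\<^sup>2 \<le> 3 * real d * (real n)\<^sup>2"
proof -
  have "(W \<omega>)\<^sup>2 \<le> 3 * real d * (real n)\<^sup>2 \<longleftrightarrow> \<bar>W \<omega>\<bar> \<le> sqrt (3 * real d * (real n)\<^sup>2)"
    using real_sqrt_le_iff[of "(W \<omega>)\<^sup>2"] by simp
  also have "\<dots> \<longleftrightarrow> \<bar>W \<omega>\<bar> \<le> sqrt (3 * real d) * real n"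
    by (simp add: real_sqrt_mult)
  also have "\<dots> \<longleftrightarrow> \<bar>statistic d n \<omega>\<bar> \<le> sqrt (3 * real d) / real n"
  proof -
    have "W \<omega> = statistic d n \<omega> * real n * real n"
      using assms(1) by (simp add: statistic_def W_def power2_eq_square)
    then show ?thesis
      using assms(1) by (simp add: abs_mult pos_le_divide_eq)
  qed
  finally show ?thesis ..
qed

section \<open>Effect and cost of the phases of the program\<close>

lemma triple_find_n:
  assumes "0 < C" "d \<ge> 1" "0 < \<epsilon>"
  shows "triple d \<omega>
    (\<lambda>s. reg s 0 = d \<and> reg s 1 = 0 \<and> mem s = (\<lambda>_. 0)(0 := \<epsilon>) \<and> drawn s = 0) (find_n C)
    (50 * sample_num C d \<epsilon>)
    (\<lambda>s. reg s 0 = d \<and> reg s 1 = sample_num C d \<epsilon> \<and> mem s = (\<lambda>_. 0)(0 := \<epsilon>) \<and> drawn s = 0)"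
proof -
  define n where "n = sample_num C d \<epsilon>"
  define I where "I k (s :: state) \<longleftrightarrow> reg s 0 = d \<and> reg s 1 = k \<and> mem s = (\<lambda>_. 0)(0 := \<epsilon>) \<and> drawn s = 0"
    for k s
  have n: "n \<ge> 1"
    unfolding n_def by (rule sample_num_pos[OF assms])
  have test: "real k * real k * (\<epsilon> * \<epsilon> * (\<epsilon> * \<epsilon>)) < 625 * C ^ 4 * real d \<longleftrightarrow> k < n" for k
    unfolding n_def less_sample_num_iff[OF assms] by (simp add: power2_eq_square power4_eq_xxxx mult.assoc)
  \<comment> \<open>A round costs 23 for the test and 4 for the increment, and the last test another
    23: in total 27 n + 23, at most 50 n because n >= 1.\<close>
  have "triple d \<omega> (I 0) (find_n C) (50 * n) (I n)"
    unfolding find_n_def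
  proof (rule triple_While)
    show "triple d \<omega> (I k) (SetReg 1 (NAdd (Reg 1) (NConst 1))) 4 (I (Suc k))" for k
      by (rule triple_SetReg) (auto simp: I_def)
  qed (use n in \<open>simp_all add: I_def test\<close>)
  then show ?thesis
    unfolding I_def n_def .
qed

text \<open>Stated for any offset and any number \<open>D\<close> of earlier draws, so that it
  covers both halves: 0 and 0 for X, d and n for Y. Memory is described as an increment on
  \<open>m\<close>, which keeps the sums of the other half.\<close>

lemma triple_add_samples:
  fixes S0 :: "nat \<Rightarrow> real"
  assumes off: "\<And>s. reg s 0 = d \<Longrightarrow> nval off s = off'" and cost: "ncost off = 1" and d: "d \<ge> 1"
    and n: "n \<ge> 1"
  shows "triple d \<omega> (\<lambda>s. reg s 0 = d \<and> reg s 1 = n \<and> mem s = m \<and> drawn s = D)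
    (add_samples off) (100 * (n * d))
    (\<lambda>s. reg s 0 = d \<and> reg s 1 = n \<and>
       mem s = (\<lambda>a. m a + (if 1 + off' \<le> a \<and> a < 1 + off' + d then
         \<Sum>i<n. \<omega> (D + i) (a - (1 + off')) else 0)) \<and> drawn s = D + n)"
proof -
  \<comment> \<open>\<open>M k j\<close> is the memory after k complete samples and the first j
    coordinates of the next one.\<close>
  define M where "M k j = (\<lambda>a. m a + (if 1 + off' \<le> a \<and> a < 1 + off' + d then
         (\<Sum>i<k. \<omega> (D + i) (a - (1 + off'))) else 0) +
         (if 1 + off' \<le> a \<and> a < 1 + off' + j then \<omega> (D + k) (a - (1 + off')) else 0))" for k j
  have M_Suc: "M k d = M (Suc k) 0" for k
    by (auto simp: M_def fun_eq_iff)
  have M_upd: "(M k j)(Suc (off' + j) := M k j (Suc (off' + j)) + \<omega> (D + k) j) = M k (Suc j)" for k j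
    by (auto simp: M_def fun_eq_iff)
  \<comment> \<open>\<open>J\<close> describes the time between drawing a sample and advancing the
    sample counter: sample D + k is in the buffer and \<open>drawn\<close> is already one
    ahead.\<close>
  define J where "J k j (s :: state) \<longleftrightarrow> reg s 0 = d \<and> reg s 1 = n \<and> reg s 2 = k \<and> mem s = M k j \<and>
    drawn s = D + Suc k \<and> buf s = (\<lambda>j. if j < d then \<omega> (D + k) j else 0)" for k j s
  define I where "I k (s :: state) \<longleftrightarrow> reg s 0 = d \<and> reg s 1 = n \<and> reg s 2 = k \<and> mem s = M k 0 \<and>
    drawn s = D + k" for k s
  \<comment> \<open>A round costs 4 for the test and 15 + 4 for the body, which B = 20 covers; 24 d
    + 4 is at most 30 d because d >= 1.\<close>
  have inner: "triple d \<omega> (\<lambda>s. J k 0 s \<and> reg s 3 = 0) (While (NLess (Reg 3) (Reg 0))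
       (Seq (SetMem (cell off) (RAdd (Mem (cell off)) (Coord (Reg 3))))
            (SetReg 3 (NAdd (Reg 3) (NConst 1))))) (30 * d) (\<lambda>s. J k d s \<and> reg s 3 = d)" for k
    by (rule triple_While[where I = "\<lambda>j s. J k j s \<and> reg s 3 = j" and N = d and B = 20],
        rule triple_Seq[where Q = "\<lambda>s. J k (Suc j) s \<and> reg s 3 = j" for j, OF triple_SetMem triple_SetReg])
       (use d in \<open>auto simp: J_def cell_def off cost M_upd\<close>)
  have step: "triple d \<omega> (I k) (add_sample off) (41 * d) (I (Suc k))" for k
    unfolding add_sample_def
  proof (rule triple_Seq)
    show "triple d \<omega> (I k) Draw (1 + d) (J k 0)"
      by (rule triple_Draw) (auto simp: I_def J_def)
    show "triple d \<omega> (J k 0) (Seq (SetReg 3 (NConst 0)) (Seq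
     (While (NLess (Reg 3) (Reg 0))
       (Seq (SetMem (cell off) (RAdd (Mem (cell off)) (Coord (Reg 3))))
            (SetReg 3 (NAdd (Reg 3) (NConst 1)))))
     (SetReg 2 (NAdd (Reg 2) (NConst 1))))) (2 + (30 * d + 4)) (I (Suc k))"
      by (rule triple_Seq[OF triple_SetReg triple_Seq[OF inner triple_SetReg]])
         (auto simp: I_def J_def M_Suc)
  qed (use d in simp)
  have "triple d \<omega> (I 0) (While (NLess (Reg 2) (Reg 1)) (add_sample off))
      (n * (1 + 3 + 41 * d) + 4) (I n)"
    by (rule triple_While[where I = I and B = "41 * d", OF step]) (auto simp: I_def algebra_simps)
  moreover have "2 + (n * (1 + 3 + 41 * d) + 4) \<le> 100 * (n * d)"
  proof -
    have "n \<le> n * d" "1 \<le> n * d"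
      using d n by simp_all
    moreover have "n * (1 + 3 + 41 * d) = 4 * n + 41 * (n * d)"
      by (simp add: algebra_simps)
    ultimately show ?thesis by linarith
  qed
  ultimately have "triple d \<omega> (\<lambda>s. reg s 0 = d \<and> reg s 1 = n \<and> mem s = m \<and> drawn s = D)
    (add_samples off) (100 * (n * d)) (I n)"
    unfolding add_samples_def
    by (intro triple_Seq[OF triple_SetReg[where T = 2]]) (auto simp: I_def M_def)
  then show ?thesis
    by (rule triple_conseq) (auto simp: I_def M_def)
qed

lemma triple_inner_product:
  assumes d: "d \<ge> 1" and W: "m (1 + 2 * d) = 0"
  shows "triple d \<omega> (\<lambda>s. reg s 0 = d \<and> reg s 1 = n \<and> mem s = m \<and> drawn s = D)
    inner_product (100 * d)
    (\<lambda>s. reg s 0 = d \<and> reg s 1 = n \<and> mem s (1 + 2 * d) = (\<Sum>j<d. m (1 + j) * m (1 + d + j)) \<and>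
      drawn s = D)"
proof -
  \<comment> \<open>Only cell 1 + 2 d changes. The cells read, 1 + j and 1 + d + j with j < d, lie
    below it and still hold their values from \<open>m\<close>.\<close>
  define I where "I j (s :: state) \<longleftrightarrow> reg s 0 = d \<and> reg s 1 = n \<and> drawn s = D \<and>
    mem s = m(1 + 2 * d := \<Sum>j<j. m (1 + j) * m (1 + d + j))" for j s
  have "triple d \<omega> (\<lambda>s. I 0 s \<and> reg s 3 = 0) (While (NLess (Reg 3) (Reg 0))
     (Seq (SetMem (NAdd (NConst 1) (NAdd (Reg 0) (Reg 0)))
             (RAdd (Mem (NAdd (NConst 1) (NAdd (Reg 0) (Reg 0))))
                   (RMul (Mem (cell (NConst 0))) (Mem (cell (Reg 0))))))
          (SetReg 3 (NAdd (Reg 3) (NConst 1))))) (50 * d) (\<lambda>s. I d s \<and> reg s 3 = d)"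
    by (rule triple_While[where I = "\<lambda>j s. I j s \<and> reg s 3 = j" and N = d and B = 40],
        rule triple_Seq[where Q = "\<lambda>s. I (Suc j) s \<and> reg s 3 = j" for j, OF triple_SetMem triple_SetReg])
       (use d in \<open>auto simp: I_def cell_def\<close>)
  then have "triple d \<omega> (\<lambda>s. reg s 0 = d \<and> reg s 1 = n \<and> mem s = m \<and> drawn s = D)
    inner_product (100 * d) (\<lambda>s. I d s \<and> reg s 3 = d)"
    unfolding inner_product_def
    by (intro triple_Seq[OF triple_SetReg[where T = 2]]) (use d W in \<open>auto simp: I_def\<close>)
  then show ?thesis
    by (rule triple_conseq) (auto simp: I_def)
qed

lemma tester_program_correct:
  assumes C: "0 < C" and d: "d \<ge> 1" and e: "0 < \<epsilon>"
  shows "\<exists>t s. exec d \<omega> (tester_program C) (init_state d \<epsilon>) t s \<and>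
        answer s = Some (tester C d \<epsilon> \<omega>) \<and>
        drawn s = 2 * sample_num C d \<epsilon> \<and>
        t \<le> 500 * sample_num C d \<epsilon> * d"
proof -
  define n where "n = sample_num C d \<epsilon>"
  have n: "n \<ge> 1"
    unfolding n_def by (rule sample_num_pos[OF C d e])
  define W where "W = (\<Sum>j<d. (\<Sum>i<n. \<omega> i j) * (\<Sum>i<n. \<omega> (n + i) j))"
  have test: "W * W \<le> 3 * real d * (real n * real n) \<longleftrightarrow> tester C d \<epsilon> \<omega> = ACCEPT"
    using abs_statistic_le_iff[OF n, of d \<omega>]
    by (simp add: tester_def n_def Let_def W_def power2_eq_square)
  \<comment> \<open>The memory after each phase. The sums with 0 are kept unsimplified so that
    \<open>m1\<close> is literally the instance of \<open>triple_add_samples\<close> for offset 0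
    and no earlier draws.\<close>
  define m0 where "m0 = ((\<lambda>_. 0)(0 := \<epsilon>) :: nat \<Rightarrow> real)"
  define m1 where "m1 = (\<lambda>a. m0 a + (if 1 + 0 \<le> a \<and> a < 1 + 0 + d then
         \<Sum>i<n. \<omega> (0 + i) (a - (1 + 0)) else 0))"
  define m2 where "m2 = (\<lambda>a. m1 a + (if 1 + d \<le> a \<and> a < 1 + d + d then
         \<Sum>i<n. \<omega> (n + i) (a - (1 + d)) else 0))"
  \<comment> \<open>Cell 1 + 2 d lies just above both blocks of accumulators, so it is still 0 when
    the inner product starts.\<close>
  have m2: "m2 (1 + 2 * d) = 0" "(\<Sum>j<d. m2 (1 + j) * m2 (1 + d + j)) = W"
    by (auto simp: m2_def m1_def m0_def W_def)
  have decide: "triple d \<omega> (\<lambda>s. reg s 0 = d \<and> reg s 1 = n \<and> mem s (1 + 2 * d) = W \<and> drawn s = n + n)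
    decide 40 (\<lambda>s. answer s = Some (tester C d \<epsilon> \<omega>) \<and> drawn s = 2 * n)"
    unfolding decide_def
  proof (rule triple_Cond)
    let ?P = "\<lambda>s. reg s 0 = d \<and> reg s 1 = n \<and> mem s (1 + 2 * d) = W \<and> drawn s = n + n"
    let ?b = "RLe (RMul (Mem (NAdd (NConst 1) (NAdd (Reg 0) (Reg 0)))) (Mem (NAdd (NConst 1) (NAdd (Reg 0) (Reg 0)))))
          (RMul (RMul (RConst 3) (OfNat (Reg 0))) (RMul (OfNat (Reg 1)) (OfNat (Reg 1))))"
    show "triple d \<omega> (\<lambda>s. ?P s \<and> tval ?b s) (Answer ACCEPT) 1
        (\<lambda>s. answer s = Some (tester C d \<epsilon> \<omega>) \<and> drawn s = 2 * n)"
      by (rule triple_Answer) (use test in \<open>auto simp: mult_2\<close>)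
    show "triple d \<omega> (\<lambda>s. ?P s \<and> \<not> tval ?b s) (Answer REJECT) 1
        (\<lambda>s. answer s = Some (tester C d \<epsilon> \<omega>) \<and> drawn s = 2 * n)"
      by (rule triple_Answer) (use test in \<open>cases "tester C d \<epsilon> \<omega>"; auto simp: mult_2\<close>)+
  qed simp
  have "triple d \<omega> (\<lambda>s. reg s 0 = d \<and> reg s 1 = 0 \<and> mem s = m0 \<and> drawn s = 0) (tester_program C)
    (500 * n * d) (\<lambda>s. answer s = Some (tester C d \<epsilon> \<omega>) \<and> drawn s = 2 * n)"
    unfolding tester_program_def
  proof (rule triple_Seq, unfold m0_def, rule triple_find_n[OF C d e, folded n_def],
      fold m0_def, rule triple_Seq)
    show "triple d \<omega> (\<lambda>s. reg s 0 = d \<and> reg s 1 = n \<and> mem s = m0 \<and> drawn s = 0)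
      (add_samples (NConst 0)) (100 * (n * d))
      (\<lambda>s. reg s 0 = d \<and> reg s 1 = n \<and> mem s = m1 \<and> drawn s = 0 + n)"
      unfolding m1_def by (rule triple_add_samples) (use d n in auto)
    show "triple d \<omega> (\<lambda>s. reg s 0 = d \<and> reg s 1 = n \<and> mem s = m1 \<and> drawn s = 0 + n)
      (Seq (add_samples (Reg 0)) (Seq inner_product decide)) (100 * (n * d) + (100 * d + 40))
      (\<lambda>s. answer s = Some (tester C d \<epsilon> \<omega>) \<and> drawn s = 2 * n)"
    proof (rule triple_Seq)
      show "triple d \<omega> (\<lambda>s. reg s 0 = d \<and> reg s 1 = n \<and> mem s = m1 \<and> drawn s = 0 + n)
        (add_samples (Reg 0)) (100 * (n * d))
        (\<lambda>s. reg s 0 = d \<and> reg s 1 = n \<and> mem s = m2 \<and> drawn s = n + n)"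
        unfolding m2_def add_0 by (rule triple_add_samples) (use d n in auto)
      show "triple d \<omega> (\<lambda>s. reg s 0 = d \<and> reg s 1 = n \<and> mem s = m2 \<and> drawn s = n + n)
        (Seq inner_product decide) (100 * d + 40)
        (\<lambda>s. answer s = Some (tester C d \<epsilon> \<omega>) \<and> drawn s = 2 * n)"
        by (rule triple_Seq[OF triple_inner_product[where m = m2, OF d m2(1)] decide[folded m2(2)] le_refl])
    qed simp
    \<comment> \<open>Since n, d and 1 are all at most n d, the phases add up to at most 390 n
      d.\<close>
    have "n * 1 \<le> n * d" "1 * d \<le> n * d" "1 * 1 \<le> n * d"
      using d n by (intro mult_mono; simp)+
    then show "50 * n + (100 * (n * d) + (100 * (n * d) + (100 * d + 40))) \<le> 500 * n * d"
      unfolding mult.assoc by linarith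
  qed simp
  then show ?thesis
    unfolding triple_def n_def m0_def
    by (elim allE[where x = "init_state d \<epsilon>"]) (auto simp: init_state_def)
qed

section \<open>Correctness of the tester\<close>

lemma completeness:
  assumes C: "0 < C" and d: "d \<ge> 1" and e: "0 < \<epsilon>" and p: "gaussian d (\<lambda>_. 0) id_matrix p"
  shows "output_prob C d \<epsilon> p ACCEPT \<ge> 2 / 3"
proof -
  define n where "n = sample_num C d \<epsilon>"
  have n: "n \<ge> 1"
    unfolding n_def by (rule sample_num_pos[OF C d e])
  \<comment> \<open>The factor need not be the identity: it is any orthogonal matrix. The second
    moments depend on it only through \<open>A\<close> times its transpose.\<close>
  obtain A where A: "\<And>i j. i < d \<Longrightarrow> j < d \<Longrightarrow> id_matrix i j = (\<Sum>k<d. A i k * A j k)"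
    and p: "p = distr (std_gaussian d) (borel_vec d) (affine_image d (\<lambda>_. 0) A)"
    using p unfolding gaussian_eq_affine_image by blast
  interpret p: prob_space p
    unfolding p by (rule prob_space_affine_image)
  define P where "P = (\<Pi>\<^sub>M i\<in>{..<2 * n}. p)"
  interpret P: prob_space P
    unfolding P_def by (intro prob_space_PiM p.prob_space_axioms)
  define W where "W = (\<lambda>\<omega> :: nat \<Rightarrow> nat \<Rightarrow> real. \<Sum>j<d. (\<Sum>i<n. \<omega> i j) * (\<Sum>i<n. \<omega> (n + i) j))"
  note moments = integrable_affine_image[of _ d "\<lambda>_. 0" A, folded p]
    integral_affine_image[of _ d "\<lambda>_. 0" A, folded p]
    integrable_affine_image_mult[of _ d _ "\<lambda>_. 0" A, folded p]
    integral_affine_image_mult[of _ d _ "\<lambda>_. 0" A, folded p]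
  have W2: "integrable P (\<lambda>\<omega>. (W \<omega>)\<^sup>2)"
    unfolding W_def P_def using n moments(1,3)
    by (intro integrable_two_sample_sq[of p "{..<d}" "\<lambda>j x. x j"] p.prob_space_axioms) auto
  have "(\<integral>\<omega>. (W \<omega>)\<^sup>2 \<partial>P) = (\<Sum>j<d. \<Sum>k<d. (real n * (\<integral>x. x j * x k \<partial>p) +
        real n * (real n - 1) * ((\<integral>x. x j \<partial>p) * (\<integral>x. x k \<partial>p)))\<^sup>2)"
    unfolding W_def P_def using n moments(1,3)
    by (intro integral_two_sample_sq[of p "{..<d}" "\<lambda>j x. x j"] p.prob_space_axioms) auto
  \<comment> \<open>All means vanish, which kills the second summand, and the mixed moments are the
    entries of the identity matrix.\<close>
  also have "\<dots> = (\<Sum>j<d. \<Sum>k<d. if j = k then (real n)\<^sup>2 else 0)"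
    by (intro sum.cong refl) (simp add: moments A[symmetric] id_matrix_def)
  also have "\<dots> = real d * (real n)\<^sup>2"
    by simp
  finally have EW2: "(\<integral>\<omega>. (W \<omega>)\<^sup>2 \<partial>P) = real d * (real n)\<^sup>2" .
  have [measurable]: "(\<lambda>\<omega>. (W \<omega>)\<^sup>2) \<in> borel_measurable P"
    using W2 by (rule borel_measurable_integrable)
  have "P.prob {\<omega> \<in> space P. 3 * real d * (real n)\<^sup>2 \<le> (W \<omega>)\<^sup>2} \<le>
      (real d * (real n)\<^sup>2) / (3 * real d * (real n)\<^sup>2)"
    unfolding EW2[symmetric]
    by (rule integral_Markov_inequality_measure[OF W2, of "{}"]) (use d n in auto)
  also have "\<dots> = 1 / 3"
    using d n by simp
  finally have "P.prob {\<omega> \<in> space P. 3 * real d * (real n)\<^sup>2 \<le> (W \<omega>)\<^sup>2} \<le> 1 / 3" .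
  \<comment> \<open>Rejection is a strict inequality, so it lies inside the event bounded by
    Markov.\<close>
  moreover have "P.prob {\<omega> \<in> space P. \<not> (W \<omega>)\<^sup>2 \<le> 3 * real d * (real n)\<^sup>2} \<le>
      P.prob {\<omega> \<in> space P. 3 * real d * (real n)\<^sup>2 \<le> (W \<omega>)\<^sup>2}"
    by (intro P.finite_measure_mono) auto
  moreover have "P.prob {\<omega> \<in> space P. \<not> (W \<omega>)\<^sup>2 \<le> 3 * real d * (real n)\<^sup>2} =
      1 - P.prob {\<omega> \<in> space P. (W \<omega>)\<^sup>2 \<le> 3 * real d * (real n)\<^sup>2}"
    by (intro P.prob_neg) measurable
  moreover have "output_prob C d \<epsilon> p ACCEPT = P.prob {\<omega> \<in> space P. (W \<omega>)\<^sup>2 \<le> 3 * real d * (real n)\<^sup>2}"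
    unfolding output_prob_def Let_def tester_def n_def[symmetric] P_def[symmetric]
      abs_statistic_le_iff[OF n] W_def
    by (intro arg_cong[where f = P.prob]) (auto split: if_splits)
  ultimately show ?thesis by linarith
qed

text \<open>The choice of n gives n M^2 >= n \<epsilon>^2 >= 25 C^2 sqrt d. With sqrt 3 <= 25/9 the
  argument of the outer root is then at most 1 / (9 C^2), whose root is 1 / (3 C).\<close>

lemma anti_concentration_constant:
  assumes C: "0 < C" and d: "d \<ge> 1" and e: "0 < \<epsilon>" and M: "\<epsilon> \<le> M"
  shows "C * sqrt (sqrt (3 * real d) / (real (sample_num C d \<epsilon>) * M\<^sup>2)) \<le> 1 / 3"
proof -
  define n where "n = sample_num C d \<epsilon>"
  have n: "n \<ge> 1"
    unfolding n_def by (rule sample_num_pos[OF C d e])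
  have "25 * C\<^sup>2 * sqrt (real d) / \<epsilon>\<^sup>2 \<le> real n"
    unfolding n_def sample_num_def by linarith
  then have "25 * C\<^sup>2 * sqrt (real d) \<le> real n * \<epsilon>\<^sup>2"
    using e by (simp add: pos_divide_le_eq)
  also have "\<dots> \<le> real n * M\<^sup>2"
    using e M by (intro mult_left_mono power_mono) auto
  finally have nM: "25 * C\<^sup>2 * sqrt (real d) \<le> real n * M\<^sup>2" .
  have pos: "0 < real n * M\<^sup>2"
    using n e M by simp
  have "sqrt 3 \<le> 25 / 9"
    by (rule real_le_lsqrt) (simp_all add: power2_eq_square)
  then have "9 * C\<^sup>2 * (sqrt 3 * sqrt (real d)) \<le> 9 * C\<^sup>2 * (25 / 9 * sqrt (real d))"
    by (intro mult_left_mono mult_right_mono) auto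
  also have "\<dots> \<le> real n * M\<^sup>2"
    using nM by (simp add: mult_ac)
  finally have "sqrt (3 * real d) / (real n * M\<^sup>2) \<le> 1 / (9 * C\<^sup>2)"
    using C pos by (simp add: field_simps real_sqrt_mult)
  then have "sqrt (sqrt (3 * real d) / (real n * M\<^sup>2)) \<le> sqrt (1 / (9 * C\<^sup>2))"
    by (rule real_sqrt_le_mono)
  also have "\<dots> = 1 / (3 * C)"
    using C by (simp add: real_sqrt_divide real_sqrt_mult)
  finally show ?thesis
    using C unfolding n_def by (simp add: field_simps)
qed

lemma soundness:
  assumes cw: "carbery_wright_const C" and d: "d \<ge> 1" and e: "0 < \<epsilon>"
    and \<mu>: "L2_set \<mu> {..<d} \<ge> \<epsilon>" and p: "gaussian d \<mu> S p"
  shows "output_prob C d \<epsilon> p REJECT \<ge> 2 / 3"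
proof -
  have C: "0 < C"
    using cw by (simp add: carbery_wright_const_def)
  define n where "n = sample_num C d \<epsilon>"
  have n: "n \<ge> 1"
    unfolding n_def by (rule sample_num_pos[OF C d e])
  obtain A where p: "p = distr (std_gaussian d) (borel_vec d) (affine_image d \<mu> A)"
    using p unfolding gaussian_eq_affine_image by blast
  interpret p: prob_space p
    unfolding p by (rule prob_space_affine_image)
  define P where "P = (\<Pi>\<^sub>M i\<in>{..<2 * n}. p)"
  interpret P: prob_space P
    unfolding P_def by (intro prob_space_PiM p.prob_space_axioms)
  define Z where "Z = statistic d n"
  define M where "M = L2_set \<mu> {..<d}"
  have M: "\<epsilon> \<le> M" and M_pos: "0 < M"
    using \<mu> e by (auto simp: M_def)
  have M2: "M\<^sup>2 = (\<Sum>j<d. (\<mu> j)\<^sup>2)"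
    unfolding M_def L2_set_def by (simp add: sum_nonneg)
  note moments = integrable_affine_image[of _ d \<mu> A, folded p]
    integral_affine_image[of _ d \<mu> A, folded p]
    integrable_affine_image_mult[of _ d _ \<mu> A, folded p]
  define W where "W = (\<lambda>\<omega> :: nat \<Rightarrow> nat \<Rightarrow> real. \<Sum>j<d. (\<Sum>i<n. \<omega> i j) * (\<Sum>i<n. \<omega> (n + i) j))"
  have Z: "Z \<omega> = 1 / (real n)\<^sup>2 * W \<omega>" for \<omega>
    by (simp add: Z_def statistic_def W_def)
  have W: "integrable P W" "integrable P (\<lambda>\<omega>. (W \<omega>)\<^sup>2)"
    unfolding W_def P_def using n moments(1,3)
    by (intro integrable_two_sample[of p "{..<d}" "\<lambda>j x. x j"]
        integrable_two_sample_sq[of p "{..<d}" "\<lambda>j x. x j"] p.prob_space_axioms; auto)+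
  have "(\<integral>\<omega>. W \<omega> \<partial>P) = (real n)\<^sup>2 * (\<Sum>j<d. (\<integral>x. x j \<partial>p)\<^sup>2)"
    unfolding W_def P_def using n moments(1,3)
    by (intro integral_two_sample[of p "{..<d}" "\<lambda>j x. x j"] p.prob_space_axioms) auto
  also have "(\<Sum>j<d. (\<integral>x. x j \<partial>p)\<^sup>2) = M\<^sup>2"
    unfolding M2 by (intro sum.cong) (simp_all add: moments)
  finally have EW: "(\<integral>\<omega>. W \<omega> \<partial>P) = (real n)\<^sup>2 * M\<^sup>2" .
  have Z_int: "integrable P Z" "integrable P (\<lambda>\<omega>. (Z \<omega>)\<^sup>2)"
    unfolding Z power_mult_distrib by (intro integrable_mult_right W)+
  have EZ: "(\<integral>\<omega>. Z \<omega> \<partial>P) = M\<^sup>2"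
    using n by (simp add: Z EW)
  \<comment> \<open>E[Z^2] is the variance plus (E Z)^2. Dropping the variance makes the bound
    uniform over all covariances, singular ones included.\<close>
  have EZ2: "(M\<^sup>2)\<^sup>2 \<le> (\<integral>\<omega>. (Z \<omega>)\<^sup>2 \<partial>P)"
  proof -
    have "0 \<le> P.variance Z"
      by (rule P.variance_positive)
    also have "\<dots> = (\<integral>\<omega>. (Z \<omega>)\<^sup>2 \<partial>P) - (M\<^sup>2)\<^sup>2"
      using P.variance_eq[OF Z_int] by (simp add: EZ)
    finally show ?thesis by simp
  qed
  \<comment> \<open>There are 2 n samples with d coordinates each, all cut out of a single Gaussian
    vector.\<close>
  define m where "m = 2 * n * d"
  define \<Phi> where "\<Phi> g = (\<lambda>b\<in>{..<2 * n}. affine_image d \<mu> A (\<lambda>k. g (b * d + k)))" for g :: "nat \<Rightarrow> real"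
  have \<Phi>_meas: "\<Phi> \<in> measurable (std_gaussian m) (\<Pi>\<^sub>M i\<in>{..<2 * n}. borel_vec d)"
    and P_distr: "P = distr (std_gaussian m) (\<Pi>\<^sub>M i\<in>{..<2 * n}. borel_vec d) \<Phi>"
    using measurable_iid_affine_image[of "2 * n" d \<mu> A]
      iid_affine_image_eq_distr[of "2 * n" d \<mu> A] n d unfolding P_def p m_def \<Phi>_def by simp_all
  have \<Phi> [measurable]: "\<Phi> \<in> measurable (std_gaussian m) P"
    using \<Phi>_meas by (simp add: P_distr)
  interpret G: prob_space "std_gaussian m" by (rule prob_space_std_gaussian)
  define q where "q g = Z (\<Phi> g)" for g
  have Z_meas [measurable]: "Z \<in> borel_measurable P"
    using Z_int(1) by (rule borel_measurable_integrable)
  have q_meas [measurable]: "q \<in> borel_measurable (std_gaussian m)"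
    unfolding q_def by measurable
  \<comment> \<open>\<open>P\<close> has the same measurable sets as the product of the Borel
    spaces, so it may replace that product as the target of the map.\<close>
  have P_eq: "distr (std_gaussian m) P \<Phi> = P"
    by (subst (2) P_distr, intro distr_cong) (simp_all add: P_distr)
  have Eq2: "(\<integral>g. (q g)\<^sup>2 \<partial>std_gaussian m) = (\<integral>\<omega>. (Z \<omega>)\<^sup>2 \<partial>P)"
    unfolding q_def using integral_distr[OF \<Phi>, of "\<lambda>\<omega>. (Z \<omega>)\<^sup>2"] by (simp add: P_eq)
  have "quadratic m q"
  proof -
    have form: "affine_form m (\<lambda>g. \<Phi> g b j)" if "b < 2 * n" "j < d" for b j
    proof -
      have "b * d + k < m" if "k < d" for k
        unfolding m_def by (rule block_index_less[OF \<open>b < 2 * n\<close> that])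
      then have "affine_form m (\<lambda>g. \<mu> j + (\<Sum>k<d. A j k * g (b * d + k)))"
        by (intro affine_form_add affine_form_const affine_form_sum affine_form_cmult
            affine_form_coordinate) simp
      then show ?thesis
        using that by (simp add: \<Phi>_def affine_image_def)
    qed
    show ?thesis
      unfolding q_def Z W_def
      by (intro quadratic_cmult quadratic_sum quadratic_affine_mult affine_form_sum form) auto
  qed
  \<comment> \<open>Carbery-Wright asks for a nonzero polynomial; a vanishing q would give E[q^2] =
    0, against E[q^2] >= M^4 > 0.\<close>
  moreover have "\<exists>g. q g \<noteq> 0"
  proof (rule ccontr)
    assume "\<nexists>g. q g \<noteq> 0"
    then have "(M\<^sup>2)\<^sup>2 \<le> 0"
      using EZ2 by (simp flip: Eq2)
    with M_pos show False by simp
  qed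
  \<comment> \<open>Chosen so that \<alpha> M^2 is exactly the acceptance threshold; as M^2 is at
    most the root of E[q^2], acceptance falls into the small-ball event.\<close>
  moreover define \<alpha> where "\<alpha> = sqrt (3 * real d) / (real n * M\<^sup>2)"
  moreover have "0 < \<alpha>"
    using n d M_pos by (simp add: \<alpha>_def)
  moreover have "1 \<le> m"
    using n d by (simp add: m_def)
  ultimately have "G.prob {g \<in> space (std_gaussian m). \<bar>q g\<bar> \<le> \<alpha> * sqrt (\<integral>g. (q g)\<^sup>2 \<partial>std_gaussian m)}
      \<le> C * sqrt \<alpha>"
    using cw unfolding carbery_wright_const_def by blast
  also have "C * sqrt \<alpha> \<le> 1 / 3"
    unfolding \<alpha>_def n_def by (rule anti_concentration_constant[OF C d e M])
  finally have *: "G.prob {g \<in> space (std_gaussian m). \<bar>q g\<bar> \<le> \<alpha> * sqrt (\<integral>g. (q g)\<^sup>2 \<partial>std_gaussian m)}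
      \<le> 1 / 3" .
  have "sqrt (3 * real d) / real n = \<alpha> * M\<^sup>2"
    using M_pos by (simp add: \<alpha>_def)
  also have "\<dots> \<le> \<alpha> * sqrt (\<integral>g. (q g)\<^sup>2 \<partial>std_gaussian m)"
    unfolding Eq2 using EZ2 \<open>0 < \<alpha>\<close> by (intro mult_left_mono real_le_rsqrt) auto
  finally have "G.prob {g \<in> space (std_gaussian m). \<bar>q g\<bar> \<le> sqrt (3 * real d) / real n} \<le>
      G.prob {g \<in> space (std_gaussian m). \<bar>q g\<bar> \<le> \<alpha> * sqrt (\<integral>g. (q g)\<^sup>2 \<partial>std_gaussian m)}"
    by (intro G.finite_measure_mono) auto
  \<comment> \<open>The acceptance event is pulled back along \<Phi> to the underlying Gaussian
    space.\<close>
  moreover have "P.prob {\<omega> \<in> space P. \<bar>Z \<omega>\<bar> \<le> sqrt (3 * real d) / real n} =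
      G.prob {g \<in> space (std_gaussian m). \<bar>q g\<bar> \<le> sqrt (3 * real d) / real n}"
    using measure_distr[OF \<Phi>, of "{\<omega> \<in> space P. \<bar>Z \<omega>\<bar> \<le> sqrt (3 * real d) / real n}"]
      measurable_space[OF \<Phi>]
    by (simp add: P_eq q_def vimage_def Int_def conj_commute cong: conj_cong)
  moreover have "P.prob {\<omega> \<in> space P. \<not> \<bar>Z \<omega>\<bar> \<le> sqrt (3 * real d) / real n} =
      1 - P.prob {\<omega> \<in> space P. \<bar>Z \<omega>\<bar> \<le> sqrt (3 * real d) / real n}"
    by (intro P.prob_neg) measurable
  moreover have "output_prob C d \<epsilon> p REJECT =
      P.prob {\<omega> \<in> space P. \<not> \<bar>Z \<omega>\<bar> \<le> sqrt (3 * real d) / real n}"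
    unfolding output_prob_def Let_def tester_def n_def[symmetric] P_def[symmetric] Z_def
    by (intro arg_cong[where f = P.prob]) (auto split: if_splits)
  ultimately show ?thesis
    using * by linarith
qed

text \<open>The lower bound combines n >= 25 C^2 r with n >= 1, hence the minimum in its constant.
  In the upper bound the extra 1 pays for rounding up, absorbed because \<open>max 1 r\<close> is at
  least 1.\<close>

lemma sample_num_bounds:
  assumes C: "0 < C" and d: "d \<ge> 1" and e: "0 < \<epsilon>"
  defines "r \<equiv> sqrt (real d) / \<epsilon>\<^sup>2"
  shows "min 1 (25 * C\<^sup>2) * max 1 r \<le> real (sample_num C d \<epsilon>)"
    and "real (sample_num C d \<epsilon>) \<le> (25 * C\<^sup>2 + 1) * max 1 r"
proof -
  have r: "0 \<le> r"
    using e by (simp add: r_def)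
  have n: "25 * C\<^sup>2 * r \<le> real (sample_num C d \<epsilon>)" "real (sample_num C d \<epsilon>) \<le> 25 * C\<^sup>2 * r + 1"
    "1 \<le> real (sample_num C d \<epsilon>)"
  proof -
    have eq: "sample_num C d \<epsilon> = nat \<lceil>25 * C\<^sup>2 * r\<rceil>" and nonneg: "0 \<le> 25 * C\<^sup>2 * r"
      using r by (simp_all add: sample_num_def r_def)
    show "25 * C\<^sup>2 * r \<le> real (sample_num C d \<epsilon>)" "real (sample_num C d \<epsilon>) \<le> 25 * C\<^sup>2 * r + 1"
      unfolding eq using nonneg by linarith+
    show "1 \<le> real (sample_num C d \<epsilon>)"
      using sample_num_pos[OF C d e] by simp
  qed
  have "min 1 (25 * C\<^sup>2) * r \<le> 25 * C\<^sup>2 * r"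
    using r by (intro mult_right_mono) auto
  with n show "min 1 (25 * C\<^sup>2) * max 1 r \<le> real (sample_num C d \<epsilon>)"
    by (auto simp: max_def)
  have "25 * C\<^sup>2 * r + 1 \<le> 25 * C\<^sup>2 * max 1 r + max 1 r"
    by (intro add_mono mult_left_mono) auto
  with n(2) show "real (sample_num C d \<epsilon>) \<le> (25 * C\<^sup>2 + 1) * max 1 r"
    by (simp add: distrib_right)
qed

theorem theorem1p1:
  fixes Cs :: real
  assumes "carbery_wright_const Cs"
  shows
    "(\<forall>d\<ge>1. \<forall>\<epsilon>>0.
        (\<forall>p. gaussian d (\<lambda>_. 0) id_matrix p \<longrightarrow> output_prob Cs d \<epsilon> p ACCEPT \<ge> 2 / 3) \<and>
        (\<forall>\<mu> S p. psd d S \<and> L2_set \<mu> {..<d} \<ge> \<epsilon> \<and> gaussian d \<mu> S p \<longrightarrow>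
           output_prob Cs d \<epsilon> p REJECT \<ge> 2 / 3)) \<and>
     (\<exists>c C. 0 < c \<and> c \<le> C \<and>
        (\<forall>d\<ge>1. \<forall>\<epsilon>>0.
           c * max 1 (sqrt (real d) / \<epsilon>\<^sup>2) \<le> real (sample_num Cs d \<epsilon>) \<and>
           real (sample_num Cs d \<epsilon>) \<le> C * max 1 (sqrt (real d) / \<epsilon>\<^sup>2))) \<and>
     (\<exists>prog (K :: nat). \<forall>d\<ge>1. \<forall>\<epsilon>>0. \<forall>\<omega>. \<exists>t s.
        exec d \<omega> prog (init_state d \<epsilon>) t s \<and>
        answer s = Some (tester Cs d \<epsilon> \<omega>) \<and>
        drawn s = 2 * sample_num Cs d \<epsilon> \<and>
        t \<le> K * sample_num Cs d \<epsilon> * d)"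
proof (intro conjI)
  have C: "0 < Cs"
    using assms by (simp add: carbery_wright_const_def)
  show "\<forall>d\<ge>1. \<forall>\<epsilon>>0.
        (\<forall>p. gaussian d (\<lambda>_. 0) id_matrix p \<longrightarrow> output_prob Cs d \<epsilon> p ACCEPT \<ge> 2 / 3) \<and>
        (\<forall>\<mu> S p. psd d S \<and> L2_set \<mu> {..<d} \<ge> \<epsilon> \<and> gaussian d \<mu> S p \<longrightarrow>
           output_prob Cs d \<epsilon> p REJECT \<ge> 2 / 3)"
    using completeness[OF C] soundness[OF assms] by blast
  show "\<exists>c C. 0 < c \<and> c \<le> C \<and>
        (\<forall>d\<ge>1. \<forall>\<epsilon>>0.
           c * max 1 (sqrt (real d) / \<epsilon>\<^sup>2) \<le> real (sample_num Cs d \<epsilon>) \<and>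
           real (sample_num Cs d \<epsilon>) \<le> C * max 1 (sqrt (real d) / \<epsilon>\<^sup>2))"
    using sample_num_bounds[OF C] C
    by (intro exI[of _ "min 1 (25 * Cs\<^sup>2)"] exI[of _ "25 * Cs\<^sup>2 + 1"]) auto
  \<comment> \<open>The witnesses are \<open>tester_program Cs\<close> and K = 500. The program
    depends only on \<open>Cs\<close>, as d and \<epsilon> are read from register 0 and memory cell
    0.\<close>
  show "\<exists>prog (K :: nat). \<forall>d\<ge>1. \<forall>\<epsilon>>0. \<forall>\<omega>. \<exists>t s.
        exec d \<omega> prog (init_state d \<epsilon>) t s \<and>
        answer s = Some (tester Cs d \<epsilon> \<omega>) \<and>
        drawn s = 2 * sample_num Cs d \<epsilon> \<and>
        t \<le> K * sample_num Cs d \<epsilon> * d"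
    using tester_program_correct[OF C] by blast
qed

end
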